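(* Let $n\ge 1$ and $1<p<\infty$. Let $R\subset\mathbb{R}^{n+1}$ be a parabolic rectangle, $0\le\gamma<1$, $\gamma<\alpha<1$, $1<q<\infty$ and $0<r\le 1$. Assume that $f\in PJN_{q,\gamma,r}^{+}(R)$. Then there exist a constant $c_R\in\mathbb{R}$ and a constant $C=C(n,p,q,r,\gamma,\alpha)>0$ (depending only on the listed parameters, not on $f$ or $R$) such that \[ \bigl| \{(x,t)\in R^{+}(\alpha): (f(x,t)-c_R)_+>\lambda\}\bigr| \le C\,\frac{\|f\|_{PJN_{q,\gamma,r}^{+}(R)}^q}{\lambda^q} \] and \[ \bigl| \{(x,t)\in R^{-}(\alpha): (f(x,t)-c_R)_->\lambda\}\bigr| \le C\,\frac{\|f\|_{PJN_{q,\gamma,r}^{+}(R)}^q}{\lambda^q} \] for every $\lambda>0$.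
   Context: Points of $\mathbb{R}^{n+1}$ are written $(x,t)$ with $x\in\mathbb{R}^n$, $t\in\mathbb{R}$; $|A|$ is the Lebesgue measure of $A\subset\mathbb{R}^{n+1}$. Positive and negative parts: $g_+=\max\{g,0\}$, $g_-=-\min\{g,0\}$; $(f-c)_\pm^r$ means $((f-c)_\pm)^r$. The integral average of $g$ over $A$ with $0<|A|<\infty$ is $⨍_A g=\frac1{|A|}\int_A g\,dx\,dt$. The exponent $1<p<\infty$ is fixed. For $x\in\mathbb{R}^n$, $L>0$, let $Q(x,L)=\{y\in\mathbb{R}^n:|y_i-x_i|\le L,\ i=1,\dots,n\}$. For $t\in\mathbb{R}$, the parabolic rectangle centered at $(x,t)$ with edge length $L$ is \[ R=R(x,t,L)=Q(x,L)\times(t-L^p,t+L^p), \] and for $-1<\gamma<1$ (the time lag) its upper and lower parts are \[ R^+(\gamma)=Q(x,L)\times(t+\gamma L^p,t+L^p),\qquad R^-(\gamma)=Q(x,L)\times(t-L^p,t-\gamma L^p). \] Parabolic John--Nirenberg space: let $R$ be a parabolic rectangle, $0\le\gamma<1$, $1<q<\infty$, $0<r<q$. A function $f\in L^r_{\mathrm{loc}}(R)$ (measurable, with $|f|^r$ integrable on compact subsets of $R$) belongs to $PJN_{q,\gamma,r}^{+}(R)$ if \[ \|f\|_{PJN_{q,\gamma,r}^{+}(R)}^q=\sup\sum_{i}|R_i^+(\gamma)|\inf_{c\in\mathbb{R}}\Bigl(\frac1{|R_i^+(\gamma)|}\int_{R_i^+(\gamma)}(f-c)_+^r\,dx\,dt+\frac1{|R_i^-(\gamma)|}\int_{R_i^-(\gamma)}(f-c)_-^r\,dx\,dt\Bigr)^{q/r}<\infty,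 \] where the supremum is taken over all countable collections $\{R_i\}$ of pairwise disjoint parabolic rectangles contained in $R$ (the collection consisting of $R$ alone is allowed). *)

theory Defs
  imports "HOL-Analysis.Analysis"
begin

text \<open>Points of the space of dimension $n+1$ are pairs of type \<open>(real^'n) \<times> real\<close>, where
  \<open>n = CARD('n) \<ge> 1\<close>. The exponent \<open>p\<close> of the parabolic geometry is an explicit parameter.\<close>

definition pos_part :: "real \<Rightarrow> real" where
  "pos_part g = max g 0"

definition neg_part :: "real \<Rightarrow> real" where
  "neg_part g = - min g 0"

definition cube :: "real^'n \<Rightarrow> real \<Rightarrow> (real^'n) set" where
  "cube x L = {y. \<forall>i. \<bar>y $ i - x $ i\<bar> \<le> L}"

definition prect :: "real \<Rightarrow> real^'n \<Rightarrow> real \<Rightarrow> real \<Rightarrow> ((real^'n) \<times> real) set" where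
  "prect p x t L = cube x L \<times> {t - L powr p <..< t + L powr p}"

definition prect_upper ::
    "real \<Rightarrow> real \<Rightarrow> real^'n \<Rightarrow> real \<Rightarrow> real \<Rightarrow> ((real^'n) \<times> real) set" where
  "prect_upper p \<gamma> x t L = cube x L \<times> {t + \<gamma> * L powr p <..< t + L powr p}"

definition prect_lower ::
    "real \<Rightarrow> real \<Rightarrow> real^'n \<Rightarrow> real \<Rightarrow> real \<Rightarrow> ((real^'n) \<times> real) set" where
  "prect_lower p \<gamma> x t L = cube x L \<times> {t - L powr p <..< t - \<gamma> * L powr p}"

text \<open>\<open>powr\<close> for extended nonnegative bases and exponents \<open>a > 0\<close>, with \<open>\<infinity>\<close> mapped to \<open>\<infinity>\<close>.\<close>

definition ennpowr :: "ennreal \<Rightarrow> real \<Rightarrow> ennreal" where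
  "ennpowr x a = (if x = \<infinity> then \<infinity> else ennreal (enn2real x powr a))"

text \<open>A subrectangle may touch the top or the bottom of the ambient rectangle, so for a function
  that is only locally integrable the averages below can be infinite; hence they are taken in
  \<open>ennreal\<close>.\<close>

definition nn_average :: "((real^'n) \<times> real) set \<Rightarrow> ((real^'n) \<times> real \<Rightarrow> real) \<Rightarrow> ennreal" where
  "nn_average A g = (\<integral>\<^sup>+z\<in>A. ennreal (g z) \<partial>lebesgue) / emeasure lebesgue A"

definition L_loc :: "real \<Rightarrow> ((real^'n) \<times> real) set \<Rightarrow> ((real^'n) \<times> real \<Rightarrow> real) set" where
  "L_loc r A = {f \<in> borel_measurable (lebesgue_on A).
     \<forall>K. compact K \<and> K \<subseteq> A \<longrightarrow> set_integrable lebesgue K (\<lambda>z. \<bar>f z\<bar> powr r)}"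

definition PJN_term ::
    "real \<Rightarrow> real \<Rightarrow> real \<Rightarrow> real \<Rightarrow> ((real^'n) \<times> real \<Rightarrow> real) \<Rightarrow> real^'n \<Rightarrow> real \<Rightarrow> real \<Rightarrow> ennreal" where
  "PJN_term p q \<gamma> r f x t L =
     emeasure lebesgue (prect_upper p \<gamma> x t L) *
     (INF c::real. ennpowr
        (nn_average (prect_upper p \<gamma> x t L) (\<lambda>z. pos_part (f z - c) powr r) +
         nn_average (prect_lower p \<gamma> x t L) (\<lambda>z. neg_part (f z - c) powr r)) (q / r))"

text \<open>A family of pairwise disjoint parabolic rectangles is given by the set of their parameters
  \<open>(x, t, L)\<close>. Different parameters give different rectangles, and a rectangle is nonempty.\<close>

definition PJN_families ::
    "real \<Rightarrow> ((real^'n) \<times> real) set \<Rightarrow> ((real^'n) \<times> real \<times> real) set set" where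
  "PJN_families p R = {S. countable S \<and>
     (\<forall>(x, t, L) \<in> S. L > 0 \<and> prect p x t L \<subseteq> R) \<and>
     disjoint_family_on (\<lambda>(x, t, L). prect p x t L) S}"

text \<open>The quantity \<open>\<parallel>f\<parallel>\<^sup>q\<close>, possibly infinite.\<close>

definition PJN_sup ::
    "real \<Rightarrow> real \<Rightarrow> real \<Rightarrow> real \<Rightarrow> ((real^'n) \<times> real) set \<Rightarrow> ((real^'n) \<times> real \<Rightarrow> real) \<Rightarrow> ennreal" where
  "PJN_sup p q \<gamma> r R f =
     (SUP S \<in> PJN_families p R. \<Sum>\<^sub>\<infinity>(x, t, L)\<in>S. PJN_term p q \<gamma> r f x t L)"

definition PJN ::
    "real \<Rightarrow> real \<Rightarrow> real \<Rightarrow> real \<Rightarrow> ((real^'n) \<times> real) set \<Rightarrow> ((real^'n) \<times> real \<Rightarrow> real) set" where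
  "PJN p q \<gamma> r R = {f \<in> L_loc r R. PJN_sup p q \<gamma> r R f < \<infinity>}"

definition PJN_norm ::
    "real \<Rightarrow> real \<Rightarrow> real \<Rightarrow> real \<Rightarrow> ((real^'n) \<times> real) set \<Rightarrow> ((real^'n) \<times> real \<Rightarrow> real) \<Rightarrow> real" where
  "PJN_norm p q \<gamma> r R f = enn2real (PJN_sup p q \<gamma> r R f) powr (1 / q)"

end

theory Submission
  imports Defs
begin

text \<open>For a subrectangle \<open>Q\<close> let \<open>c\<^sub>Q\<close> be a constant that attains the infimum in the definition of the
seminorm and let \<open>a\<^sub>Q\<close> be the resulting oscillation. Chebyshev's inequality turns \<open>a\<^sub>Q\<close> into two
one-sided statements: \<open>f\<close> is at most \<open>c\<^sub>Q + h\<close> on the upper part of \<open>Q\<close> and at least \<open>c\<^sub>Q - h\<close> on its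
lower part, each outside a fraction \<open>(a\<^sub>Q / h)\<^sup>r\<close>. For disjoint rectangles the sum of
\<open>\<bar>Q\<^sup>+\<bar> a\<^sub>Q\<^sup>q\<close> is at most \<open>\<parallel>f\<parallel>\<^sup>q\<close>. The two statements meet when \<open>Q\<close> lies inside the upper part of a
larger rectangle \<open>Q'\<close>: there \<open>f\<close> is large on half of the lower part of \<open>Q\<close> if \<open>c\<^sub>Q\<close> is large, but \<open>f\<close>
can exceed \<open>c\<^bsub>Q'\<^esub>\<close> only on a small fraction of the upper part of \<open>Q'\<close>.

To exploit this, every point \<open>z\<close> of \<open>R\<^sup>+(\<alpha>)\<close> gets a chain of shrinking rectangles that starts with \<open>R\<close>,
such that each contains \<open>z\<close> in its upper part and the next one lies inside that upper part. The first
step of the chain needs the room between \<open>\<gamma>\<close> and \<open>\<alpha>\<close>; near the top and the sides of \<open>R\<close> the rectangles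
are pushed inwards. The \<open>k\<close>-th rectangle depends only on the cell of generation \<open>k\<close> that contains \<open>z\<close>,
for a nested sequence of partitions into half-open boxes comparable to the rectangles.
The rectangles themselves overlap (and adjacent ones with closed cubes as bases would not be disjoint
either), so disjoint families are always extracted by a Vitali selection.

Let \<open>high h\<close> be the union of the cells with \<open>c\<^sub>Q > c\<^sub>R + h\<close> and \<open>bad h\<close> that of the cells with
\<open>a\<^sub>Q > h\<close>. Vitali selection gives \<open>\<bar>bad h\<bar> \<le> C \<parallel>f\<parallel>\<^sup>q / h\<^sup>q\<close>. Stopping at the first cells in
\<open>high h\<close> and comparing there \<open>f\<close> with the constant of the parent gives the good-lambda inequality
(\<open>good_lambda\<close>): \<open>\<bar>high (2 h)\<bar> \<le> \<bar>bad (\<epsilon> h)\<bar> + C \<epsilon>\<^sup>r \<bar>high h\<bar>\<close>. The parent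
exists because the constant of \<open>R\<close> is \<open>c\<^sub>R\<close> itself. All sets have finite measure, so iteration gives \<open>\<bar>high h\<bar> \<le> C \<parallel>f\<parallel>\<^sup>q / h\<^sup>q\<close> (\<open>emeasure_high\<close>). A density argument shows
that \<open>f \<le> c\<^sub>R + 2 h\<close> almost everywhere off \<open>high h \<union> bad (\<epsilon> h)\<close> (\<open>level_set_minus_high_bad_null\<close>).

Reversing time and replacing \<open>f\<close> by \<open>-f\<close> exchanges the two parts, so a sign \<open>\<sigma>\<close> is carried through the
geometry and both estimates are instances of \<open>weak_type_signed\<close>. They hold with the same \<open>c\<^sub>R\<close>
because it is characterised, symmetrically, as a minimiser for \<open>R\<close>.\<close>

section \<open>Covering and exhaustion\<close>

text \<open>The greedy choice: keep a set of least rank (that is, of largest size), discard everything that meets it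
and repeat.\<close>

lemma finite_vitali_selection:
  fixes rank :: "'v \<Rightarrow> nat" and P :: "'v \<Rightarrow> 'a set"
  assumes "finite F"
  shows "\<exists>F' \<subseteq> F. disjoint_family_on P F' \<and>
    (\<forall>v\<in>F. \<exists>w\<in>F'. rank w \<le> rank v \<and> (v = w \<or> P v \<inter> P w \<noteq> {}))"
  using assms
proof (induction "card F" arbitrary: F rule: less_induct)
  case less
  show ?case
  proof (cases "F = {}")
    case True
    then show ?thesis by (auto simp: disjoint_family_on_def)
  next
    case False
    define w where "w = arg_min_on rank F"
    have w: "w \<in> F" "\<And>v. v \<in> F \<Longrightarrow> rank w \<le> rank v"
      using arg_min_if_finite(1)[OF less.prems False, of rank]
        arg_min_least[OF less.prems False, of _ rank] unfolding w_def by auto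
    define G where "G = {v \<in> F. v \<noteq> w \<and> P v \<inter> P w = {}}"
    have G: "finite G" "card G < card F"
      using less.prems w(1) by (auto simp: G_def intro!: psubset_card_mono)
    from less.hyps[OF G(2) G(1)] obtain G' where G': "G' \<subseteq> G" "disjoint_family_on P G'"
      "\<forall>v\<in>G. \<exists>u\<in>G'. rank u \<le> rank v \<and> (v = u \<or> P v \<inter> P u \<noteq> {})" by blast
    have "disjoint_family_on P (insert w G')"
      using G' unfolding disjoint_family_on_def G_def by blast
    moreover have "\<forall>v\<in>F. \<exists>u\<in>insert w G'. rank u \<le> rank v \<and> (v = u \<or> P v \<inter> P u \<noteq> {})"
    proof
      fix v assume v: "v \<in> F"
      show "\<exists>u\<in>insert w G'. rank u \<le> rank v \<and> (v = u \<or> P v \<inter> P u \<noteq> {})"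
      proof (cases "v \<in> G")
        case True then show ?thesis using G'(3) by blast
      next
        case False
        then have "v = w \<or> P v \<inter> P w \<noteq> {}" using v by (auto simp: G_def)
        then show ?thesis using w(2)[OF v] by blast
      qed
    qed
    moreover have "insert w G' \<subseteq> F" using G' w by (auto simp: G_def)
    ultimately show ?thesis by blast
  qed
qed

text \<open>Continuity from below; it reduces all covering estimates to finite families, for which the greedy
selection terminates.\<close>

lemma emeasure_UN_le_if_finite:
  assumes "countable I" and meas: "\<And>i. i \<in> I \<Longrightarrow> E i \<in> sets M"
    and le: "\<And>F. finite F \<Longrightarrow> F \<subseteq> I \<Longrightarrow> emeasure M (\<Union>i\<in>F. E i) \<le> b"
  shows "emeasure M (\<Union>i\<in>I. E i) \<le> b"
proof (cases "I = {}")
  case True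
  then show ?thesis by simp
next
  case False
  define g where "g = from_nat_into I"
  have g: "range g = I" using False assms(1) by (simp add: g_def range_from_nat_into)
  define A where "A n = (\<Union>i\<in>g ` {..n}. E i)" for n
  have gI: "g n \<in> I" for n using g by auto
  have "(\<Union>i\<in>I. E i) = (\<Union>n. A n)" unfolding A_def g[symmetric] by auto
  moreover have "(SUP n. emeasure M (A n)) = emeasure M (\<Union>n. A n)"
  proof (rule SUP_emeasure_incseq)
    show "range A \<subseteq> sets M" using meas gI by (auto simp: A_def)
    show "incseq A" by (force simp: A_def incseq_def)
  qed
  moreover have "(SUP n. emeasure M (A n)) \<le> b"
    unfolding A_def using gI by (intro SUP_least le) auto
  ultimately show ?thesis by simp
qed

lemma ennreal_absorb_half:
  assumes le: "A \<le> B + ennreal (1/2) * A" and A: "A < \<infinity>"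
  shows "A \<le> 2 * B"
proof (cases "B = \<infinity>")
  case True
  then show ?thesis by (simp add: ennreal_mult_top)
next
  case False
  obtain x where x: "A = ennreal x" "0 \<le> x"
    using A by (metis ennreal_cases infinity_ennreal_def less_irrefl)
  obtain y where y: "B = ennreal y" "0 \<le> y"
    using False by (metis ennreal_cases infinity_ennreal_def)
  have "ennreal (1/2) * ennreal x = ennreal (1/2 * x)"
    using x by (intro ennreal_mult[symmetric]) auto
  moreover have "ennreal y + ennreal (1/2 * x) = ennreal (y + 1/2 * x)"
    using x y by (intro ennreal_plus[symmetric]) auto
  ultimately have "ennreal x \<le> ennreal (y + 1/2 * x)" using le unfolding x(1) y(1) by simp
  then have "x \<le> 2 * y" using x y by (subst (asm) ennreal_le_iff) auto
  then have "ennreal x \<le> ennreal (2 * y)" by (rule ennreal_leI)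
  then show ?thesis using x y by (simp add: ennreal_mult)
qed

section \<open>The good-lambda inequality on a tree of cells\<close>

text \<open>The value \<open>\<epsilon>\<close> for which the factor \<open>2 * C1 * C2 * (2 * \<epsilon>) powr r\<close> in the good-lambda inequality equals
\<open>2 powr - q / 2\<close>: doubling the level costs a factor \<open>2 powr q\<close>, and half of it must be left over
for the iteration to contract.\<close>

definition tolerance :: "real \<Rightarrow> real \<Rightarrow> real \<Rightarrow> real \<Rightarrow> real" where
  "tolerance C1 C2 q r = (2 powr - q / (4 * C1 * C2)) powr (1 / r) / 2"

definition weak_const :: "real \<Rightarrow> real \<Rightarrow> real \<Rightarrow> real \<Rightarrow> real" where
  "weak_const C1 C2 q r = 2 powr q * (2 * 2 powr q + 1) * C2 / tolerance C1 C2 q r powr q"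

text \<open>The part of the argument that does not see the parabolic geometry. A node is a generation together with
the index of a cell of that generation; \<open>P\<close>, \<open>Up\<close>, \<open>Lo\<close> and \<open>D\<close> are its rectangle, the upper and the lower
part of the rectangle, and a dilate that swallows every later cell whose rectangle meets it. The number \<open>c v\<close>
plays the role of a mean value of \<open>f\<close>, and \<open>a v\<close> that of an oscillation.\<close>

locale cell_tree =
  fixes X :: "'a::euclidean_space set" and idx :: "nat \<Rightarrow> 'a \<Rightarrow> 'i::countable"
    and P Up Lo D :: "nat \<times> 'i \<Rightarrow> 'a set" and P0 :: "'a set"
    and f :: "'a \<Rightarrow> real" and c a :: "nat \<times> 'i \<Rightarrow> real" and c0 N C1 C2 q r :: real
  fixes node cell nodes
  defines "node \<equiv> (\<lambda>k z. (k, idx k z))"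
    and "cell \<equiv> (\<lambda>v. {z. idx (fst v) z = snd v})"
    and "nodes \<equiv> {(k, idx k z) |k z. z \<in> X}"
  assumes refine: "idx (Suc k) z = idx (Suc k) z' \<Longrightarrow> idx k z = idx k z'"
    and cell_sets: "cell v \<in> sets lebesgue"
    and cells_shrink: "open T \<Longrightarrow> z \<in> T \<Longrightarrow> \<exists>k. cell (node k z) \<subseteq> T"
    and X_sets: "X \<in> sets lebesgue" and X_P0: "X \<subseteq> P0"
    and P0_sets: "P0 \<in> sets lebesgue" and P0_finite: "emeasure lebesgue P0 < \<infinity>"
    and Up_sets: "Up v \<in> sets lebesgue" and Lo_sets: "Lo v \<in> sets lebesgue"
    and D_sets: "D v \<in> sets lebesgue"
    and Up_P: "Up v \<subseteq> P v" and Lo_P: "Lo v \<subseteq> P v"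
    and P_P0: "v \<in> nodes \<Longrightarrow> P v \<subseteq> P0"
    and X_Up: "v \<in> nodes \<Longrightarrow> X \<inter> cell v \<subseteq> Up v"
    and P_nested: "z \<in> X \<Longrightarrow> P (node (Suc k) z) \<subseteq> Up (node k z)"
    and Lo_Up: "emeasure lebesgue (Lo v) = emeasure lebesgue (Up v)"
    and Up_cell: "z \<in> X \<Longrightarrow>
      emeasure lebesgue (Up (node k z)) \<le> ennreal C1 * emeasure lebesgue (cell (node (Suc k) z))"
    and D_Up: "emeasure lebesgue (D v) \<le> ennreal C2 * emeasure lebesgue (Up v)"
    and cell_D: "v \<in> nodes \<Longrightarrow> w \<in> nodes \<Longrightarrow> fst w \<le> fst v \<Longrightarrow> v = w \<or> P v \<inter> P w \<noteq> {} \<Longrightarrow>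
      cell v \<subseteq> D w"
    and f_meas: "{z \<in> P0. f z > h} \<in> sets lebesgue"
    and osc_Up: "v \<in> nodes \<Longrightarrow> h > 0 \<Longrightarrow> emeasure lebesgue {z \<in> Up v. f z - c v > h}
      \<le> ennreal ((a v / h) powr r) * emeasure lebesgue (Up v)"
    and osc_Lo: "v \<in> nodes \<Longrightarrow> h > 0 \<Longrightarrow> emeasure lebesgue {z \<in> Lo v. c v - f z > h}
      \<le> ennreal ((a v / h) powr r) * emeasure lebesgue (Lo v)"
    and a_nonneg: "v \<in> nodes \<Longrightarrow> 0 \<le> a v"
    and packing: "finite F \<Longrightarrow> F \<subseteq> nodes \<Longrightarrow> disjoint_family_on P F \<Longrightarrow>
      (\<Sum>v\<in>F. emeasure lebesgue (Up v) * ennreal (a v powr q)) \<le> ennreal N"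
    and c_root: "z \<in> X \<Longrightarrow> c (node 0 z) = c0"
    and const_pos: "0 \<le> N" "1 \<le> C1" "1 \<le> C2" "0 < q" "0 < r"
begin

lemma refine_le: "j \<le> k \<Longrightarrow> idx k z = idx k z' \<Longrightarrow> idx j z = idx j z'"
  by (induction rule: dec_induct) (auto dest: refine)

lemma node_in_nodes: "z \<in> X \<Longrightarrow> node k z \<in> nodes"
  unfolding node_def nodes_def by blast

lemma nodesE: assumes "v \<in> nodes" obtains z k where "z \<in> X" "v = node k z"
  using assms unfolding node_def nodes_def by blast

lemma in_cell_node: "z \<in> cell (node k z)"
  unfolding cell_def node_def by simp

lemma in_cell_iff: "z' \<in> cell (node k z) \<longleftrightarrow> node k z' = node k z"
  unfolding cell_def node_def by simp

lemma in_cellD: "z \<in> cell v \<Longrightarrow> v = node (fst v) z"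
  unfolding cell_def node_def by auto

lemma node_le: "j \<le> k \<Longrightarrow> node k z = node k z' \<Longrightarrow> node j z = node j z'"
  using refine_le[of j k z z'] by (simp add: node_def)

lemma cell_antimono: "j \<le> k \<Longrightarrow> cell (node k z) \<subseteq> cell (node j z)"
  unfolding subset_iff in_cell_iff by (blast intro: node_le)

lemma P_nested_less:
  assumes "z \<in> X" "j < k" shows "P (node k z) \<subseteq> Up (node j z)"
  using assms(2)
proof (induction rule: strict_inc_induct)
  case (base i) then show ?case using P_nested[OF assms(1)] by simp
next
  case (step i)
  then show ?case using P_nested[OF assms(1), of i] Up_P[of "node (Suc i) z"] by blast
qed

lemma f_sets: assumes "A \<in> sets lebesgue" "A \<subseteq> P0"
  shows "{z \<in> A. f z > h} \<in> sets lebesgue" "{z \<in> A. f z \<ge> h} \<in> sets lebesgue"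
    "{z \<in> A. f z < h} \<in> sets lebesgue"
proof -
  have m: "{z \<in> A. f z > h} \<in> sets lebesgue" for h
  proof -
    have "{z \<in> A. f z > h} = A \<inter> {z \<in> P0. f z > h}" using assms by auto
    then show ?thesis using f_meas assms by auto
  qed
  have g: "{z \<in> A. f z \<ge> h} = A \<inter> (\<Inter>n::nat. {z \<in> A. f z > h - 1 / Suc n})"
  proof (intro set_eqI iffI)
    fix z assume z: "z \<in> A \<inter> (\<Inter>n::nat. {z \<in> A. f z > h - 1 / Suc n})"
    have "f z \<ge> h"
    proof (rule ccontr)
      assume "\<not> f z \<ge> h"
      then obtain n where "1 / Suc n < h - f z"
        using reals_Archimedean[of "h - f z"] by (auto simp: inverse_eq_divide)
      moreover have "f z > h - 1 / Suc n" using z by auto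
      ultimately show False by linarith
    qed
    then show "z \<in> {z \<in> A. f z \<ge> h}" using z by auto
  next
    fix z assume z: "z \<in> {z \<in> A. f z \<ge> h}"
    moreover have "h - 1 / Suc n < f z" for n
    proof -
      have "h - 1 / Suc n < h" by simp
      also have "\<dots> \<le> f z" using z by simp
      finally show ?thesis .
    qed
    ultimately show "z \<in> A \<inter> (\<Inter>n::nat. {z \<in> A. f z > h - 1 / Suc n})" by simp
  qed
  show "{z \<in> A. f z > h} \<in> sets lebesgue" by (rule m)
  show gm: "{z \<in> A. f z \<ge> h} \<in> sets lebesgue" unfolding g using m assms(1)
    by (intro sets.Int sets.countable_INT) auto
  have "{z \<in> A. f z < h} = A - {z \<in> A. f z \<ge> h}" by auto
  then show "{z \<in> A. f z < h} \<in> sets lebesgue" using gm assms(1) by auto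
qed

lemma f_diff_sets: assumes "A \<in> sets lebesgue" "A \<subseteq> P0"
  shows "{z \<in> A. f z - d > h} \<in> sets lebesgue" "{z \<in> A. d - f z > h} \<in> sets lebesgue"
proof -
  have "{z \<in> A. f z - d > h} = {z \<in> A. f z > h + d}" "{z \<in> A. d - f z > h} = {z \<in> A. f z < d - h}"
    by auto
  then show "{z \<in> A. f z - d > h} \<in> sets lebesgue" "{z \<in> A. d - f z > h} \<in> sets lebesgue"
    using f_sets[OF assms] by simp_all
qed

text \<open>Since the dilates of a disjoint subfamily already cover, the measure of a union of cells is controlled by
disjoint rectangles, which is the only situation in which the seminorm gives information.\<close>

lemma covering:
  assumes "finite F" "F \<subseteq> nodes"
  obtains F' where "F' \<subseteq> F" "disjoint_family_on P F'"
    "emeasure lebesgue (\<Union>v\<in>F. cell v) \<le> ennreal C2 * (\<Sum>w\<in>F'. emeasure lebesgue (Up w))"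
proof -
  obtain F' where F': "F' \<subseteq> F" "disjoint_family_on P F'"
    "\<forall>v\<in>F. \<exists>w\<in>F'. fst w \<le> fst v \<and> (v = w \<or> P v \<inter> P w \<noteq> {})"
    using finite_vitali_selection[OF assms(1), of P fst] by blast
  have fin: "finite F'" using F'(1) assms(1) by (rule finite_subset)
  have "(\<Union>v\<in>F. cell v) \<subseteq> (\<Union>w\<in>F'. D w)"
  proof (rule UN_least)
    fix v assume v: "v \<in> F"
    then obtain w where w: "w \<in> F'" "fst w \<le> fst v" "v = w \<or> P v \<inter> P w \<noteq> {}" using F'(3) by blast
    have "cell v \<subseteq> D w" using cell_D[of v w] w v assms(2) F'(1) by blast
    then show "cell v \<subseteq> (\<Union>w\<in>F'. D w)" using w(1) by blast
  qed
  then have "emeasure lebesgue (\<Union>v\<in>F. cell v) \<le> emeasure lebesgue (\<Union>w\<in>F'. D w)"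
    using D_sets fin by (intro emeasure_mono) auto
  also have "\<dots> \<le> (\<Sum>w\<in>F'. emeasure lebesgue (D w))"
    using D_sets fin by (intro emeasure_subadditive_finite) auto
  also have "\<dots> \<le> (\<Sum>w\<in>F'. ennreal C2 * emeasure lebesgue (Up w))"
    by (intro sum_mono D_Up)
  also have "\<dots> = ennreal C2 * (\<Sum>w\<in>F'. emeasure lebesgue (Up w))"
    by (simp add: sum_distrib_left)
  finally show ?thesis using F' that by blast
qed

definition bad :: "real \<Rightarrow> 'a set" where
  "bad h = (\<Union>v\<in>{v \<in> nodes. a v > h}. cell v)"

definition high :: "real \<Rightarrow> 'a set" where
  "high h = (\<Union>v\<in>{v \<in> nodes. c v > c0 + h}. cell v)"

lemma bad_sets: "bad h \<in> sets lebesgue"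
  unfolding bad_def by (intro sets.countable_UN') (auto simp: cell_sets)

lemma high_sets: "high h \<in> sets lebesgue"
  unfolding high_def by (intro sets.countable_UN') (auto simp: cell_sets)

lemma emeasure_bad:
  assumes h: "0 < h"
  shows "emeasure lebesgue (bad h) \<le> ennreal (C2 * N / h powr q)"
  unfolding bad_def
proof (rule emeasure_UN_le_if_finite)
  fix F assume F: "finite F" "F \<subseteq> {v \<in> nodes. a v > h}"
  obtain F' where F': "F' \<subseteq> F" "disjoint_family_on P F'"
    "emeasure lebesgue (\<Union>v\<in>F. cell v) \<le> ennreal C2 * (\<Sum>w\<in>F'. emeasure lebesgue (Up w))"
    using covering[of F] F by blast
  have fin: "finite F'" using F'(1) F(1) by (rule finite_subset)
  have "ennreal (h powr q) * (\<Sum>w\<in>F'. emeasure lebesgue (Up w))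
      = (\<Sum>w\<in>F'. emeasure lebesgue (Up w) * ennreal (h powr q))"
    by (simp add: sum_distrib_left mult.commute)
  also have "\<dots> \<le> (\<Sum>w\<in>F'. emeasure lebesgue (Up w) * ennreal (a w powr q))"
    using F F'(1) h const_pos by (intro sum_mono mult_left_mono ennreal_leI powr_mono2) auto
  also have "\<dots> \<le> ennreal N" using F F' fin by (intro packing) auto
  finally have 1: "ennreal (h powr q) * (\<Sum>w\<in>F'. emeasure lebesgue (Up w)) \<le> ennreal N" .
  have "(\<Sum>w\<in>F'. emeasure lebesgue (Up w))
      = ennreal (1 / h powr q) * (ennreal (h powr q) * (\<Sum>w\<in>F'. emeasure lebesgue (Up w)))"
    using h by (simp add: mult.assoc[symmetric] ennreal_mult[symmetric])
  also have "\<dots> \<le> ennreal (1 / h powr q) * ennreal N" by (intro mult_left_mono 1) auto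
  finally have "ennreal C2 * (\<Sum>w\<in>F'. emeasure lebesgue (Up w)) \<le> ennreal C2 * (ennreal (1 / h powr q) * ennreal N)"
    by (intro mult_left_mono) auto
  also have "\<dots> = ennreal (C2 * N / h powr q)"
    using const_pos by (simp add: ennreal_mult[symmetric])
  finally show "emeasure lebesgue (\<Union>v\<in>F. cell v) \<le> ennreal (C2 * N / h powr q)" using F'(3) by auto
qed (auto simp: cell_sets)

lemma emeasure_cells_finite:
  assumes "V \<subseteq> nodes"
  shows "emeasure lebesgue (\<Union>v\<in>V. cell v) \<le> ennreal C2 * emeasure lebesgue P0"
proof (rule emeasure_UN_le_if_finite)
  fix F assume F: "finite F" "F \<subseteq> V"
  obtain F' where F': "F' \<subseteq> F" "disjoint_family_on P F'"
    "emeasure lebesgue (\<Union>v\<in>F. cell v) \<le> ennreal C2 * (\<Sum>w\<in>F'. emeasure lebesgue (Up w))"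
    using covering[of F] F assms by blast
  have fin: "finite F'" using F'(1) F(1) by (rule finite_subset)
  have "disjoint_family_on Up F'"
    using F'(2) Up_P unfolding disjoint_family_on_def by blast
  then have "(\<Sum>w\<in>F'. emeasure lebesgue (Up w)) = emeasure lebesgue (\<Union>w\<in>F'. Up w)"
    using fin Up_sets by (intro sum_emeasure) auto
  also have "\<dots> \<le> emeasure lebesgue P0"
  proof (intro emeasure_mono P0_sets)
    show "(\<Union>w\<in>F'. Up w) \<subseteq> P0" using P_P0 Up_P F' F assms by blast
  qed
  finally show "emeasure lebesgue (\<Union>v\<in>F. cell v) \<le> ennreal C2 * emeasure lebesgue P0"
    using F'(3) by (meson mult_left_mono order_trans zero_le)
qed (auto simp: cell_sets)

text \<open>The heart of the matter: the descendants of \<open>node j z0\<close> that are not bad and on which the constant has increased by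
more than \<open>h\<close> have lower parts inside its upper part, where at least half of each of these lower parts
belongs to \<open>{f > c (node j z0) + h / 2}\<close>. The oscillation of \<open>node j z0\<close> makes that set small.\<close>

lemma high_descends:
  assumes h: "0 < h" and "0 < \<epsilon>" and e2: "(2 * \<epsilon>) powr r \<le> 1 / 2"
    and z0: "z0 \<in> X" and cu: "c (node j z0) \<le> c0 + h" and au: "a (node j z0) \<le> \<epsilon> * h"
    and V: "V \<subseteq> {node m z |m z. z \<in> X \<and> node j z = node j z0 \<and> j < m \<and>
      c (node m z) > c0 + 2 * h \<and> a (node m z) \<le> \<epsilon> * h}"
  shows "emeasure lebesgue (\<Union>v\<in>V. cell v)
    \<le> ennreal (2 * C1 * C2 * (2 * \<epsilon>) powr r) * emeasure lebesgue (cell (node (Suc j) z0))"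
proof (rule emeasure_UN_le_if_finite)
  let ?u = "node j z0"
  let ?T = "{z \<in> Up ?u. f z - c ?u > h / 2}"
  have u: "?u \<in> nodes" using z0 by (rule node_in_nodes)
  have h2: "0 < h/2" using h by simp
  fix F assume F: "finite F" "F \<subseteq> V"
  have Vn: "V \<subseteq> nodes" using V node_in_nodes by blast
  obtain F' where F': "F' \<subseteq> F" "disjoint_family_on P F'"
    "emeasure lebesgue (\<Union>v\<in>F. cell v) \<le> ennreal C2 * (\<Sum>w\<in>F'. emeasure lebesgue (Up w))"
    using covering[of F] F Vn by blast
  have fin: "finite F'" using F'(1) F(1) by (rule finite_subset)
  have oscle: "ennreal ((a v / (h/2)) powr r) \<le> ennreal ((2 * \<epsilon>) powr r)"
    if "v \<in> nodes" "a v \<le> \<epsilon> * h" for v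
  proof (intro ennreal_leI powr_mono2)
    show "a v / (h/2) \<le> 2 * \<epsilon>" using that h by (simp add: field_simps)
  qed (use that a_nonneg h const_pos in auto)
  \<comment> \<open>the part of \<open>Lo w\<close> on which \<open>f\<close> is not much smaller than \<open>c w\<close>\<close>
  define G where "G w = {z \<in> Lo w. f z \<ge> c w - h/2}" for w
  have LoP0: "Lo w \<subseteq> P0" if "w \<in> nodes" for w using that Lo_P P_P0 by blast
  have Gs: "G w \<in> sets lebesgue" if "w \<in> nodes" for w
    unfolding G_def using that LoP0 by (intro f_sets Lo_sets) auto
  have half: "emeasure lebesgue (Up w) \<le> 2 * emeasure lebesgue (G w)" if w: "w \<in> F'" for w
  proof -
    have wn: "w \<in> nodes" and wa: "a w \<le> \<epsilon> * h" using w F'(1) F V Vn by blast+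
    let ?L = "{z \<in> Lo w. c w - f z > h/2}"
    have Ls: "?L \<in> sets lebesgue"
      using f_diff_sets(2)[OF Lo_sets LoP0[OF wn]] .
    have "emeasure lebesgue ?L \<le> ennreal ((a w / (h/2)) powr r) * emeasure lebesgue (Lo w)"
      using osc_Lo[OF wn h2] .
    also have "\<dots> \<le> ennreal (1/2) * emeasure lebesgue (Lo w)"
      by (rule mult_right_mono[OF order_trans[OF oscle[OF wn wa] ennreal_leI[OF e2]]]) simp
    finally have L: "emeasure lebesgue ?L \<le> ennreal (1/2) * emeasure lebesgue (Lo w)" .
    have fin': "emeasure lebesgue (Lo w) < \<infinity>"
      using emeasure_mono[OF LoP0[OF wn] P0_sets] P0_finite by (meson le_less_trans)
    have "emeasure lebesgue (Lo w) = emeasure lebesgue (G w \<union> ?L)"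
      by (rule arg_cong[where f="emeasure lebesgue"]) (auto simp: G_def)
    also have "\<dots> \<le> emeasure lebesgue (G w) + emeasure lebesgue ?L"
      using Gs[OF wn] Ls by (rule emeasure_subadditive)
    also have "\<dots> \<le> emeasure lebesgue (G w) + ennreal (1/2) * emeasure lebesgue (Lo w)"
      using L by (rule add_left_mono)
    finally have 1: "emeasure lebesgue (Lo w) \<le> emeasure lebesgue (G w) + ennreal (1/2) * emeasure lebesgue (Lo w)" .
    show ?thesis using ennreal_absorb_half[OF 1 fin'] Lo_Up[of w] by simp
  qed
  have GT: "G w \<subseteq> ?T" if w: "w \<in> F'" for w
  proof -
    obtain m z where mz: "w = node m z" "z \<in> X" "node j z = node j z0" "j < m" "c w > c0 + 2 * h"
      using w F'(1) F V by blast
    have "Lo w \<subseteq> Up ?u" using P_nested_less[OF mz(2,4)] Lo_P[of w] mz(1,3) by auto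
    then show ?thesis using mz(5) cu by (auto simp: G_def)
  qed
  have Ts: "?T \<in> sets lebesgue"
    using Up_P P_P0[OF u] by (intro f_diff_sets Up_sets) blast
  have F'n: "F' \<subseteq> nodes" using F' F Vn by blast
  have "(\<Sum>w\<in>F'. emeasure lebesgue (Up w)) \<le> (\<Sum>w\<in>F'. 2 * emeasure lebesgue (G w))"
    by (intro sum_mono half)
  also have "\<dots> = 2 * (\<Sum>w\<in>F'. emeasure lebesgue (G w))" by (simp add: sum_distrib_left)
  also have "(\<Sum>w\<in>F'. emeasure lebesgue (G w)) = emeasure lebesgue (\<Union>w\<in>F'. G w)"
  proof (rule sum_emeasure)
    show "G ` F' \<subseteq> sets lebesgue" using Gs F'n by blast
    have "G w \<subseteq> P w" for w using Lo_P[of w] by (auto simp: G_def)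
    then show "disjoint_family_on G F'"
      using F'(2) unfolding disjoint_family_on_def by blast
  qed (rule fin)
  also have "\<dots> \<le> emeasure lebesgue ?T"
    by (rule emeasure_mono[OF UN_least[OF GT] Ts])
  also have "\<dots> \<le> ennreal ((a ?u / (h/2)) powr r) * emeasure lebesgue (Up ?u)"
    using osc_Up[OF u h2] .
  also have "\<dots> \<le> ennreal ((2 * \<epsilon>) powr r) * (ennreal C1 * emeasure lebesgue (cell (node (Suc j) z0)))"
    using oscle[OF u au] Up_cell[OF z0] by (intro mult_mono) auto
  finally have "(\<Sum>w\<in>F'. emeasure lebesgue (Up w))
    \<le> 2 * (ennreal ((2 * \<epsilon>) powr r) * (ennreal C1 * emeasure lebesgue (cell (node (Suc j) z0))))"
    by (simp add: mult_left_mono)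
  then have "emeasure lebesgue (\<Union>v\<in>F. cell v) \<le> ennreal C2 *
      (2 * (ennreal ((2 * \<epsilon>) powr r) * (ennreal C1 * emeasure lebesgue (cell (node (Suc j) z0)))))"
    using F'(3) by (meson mult_left_mono order_trans zero_le)
  also have "\<dots> = ennreal C2 * (ennreal 2 * (ennreal ((2 * \<epsilon>) powr r) * ennreal C1)) * emeasure lebesgue (cell (node (Suc j) z0))"
    by (simp add: mult.assoc)
  also have "ennreal C2 * (ennreal 2 * (ennreal ((2 * \<epsilon>) powr r) * ennreal C1)) = ennreal (2 * C1 * C2 * (2 * \<epsilon>) powr r)"
    using const_pos by (simp add: ennreal_mult mult_ac)
  finally show "emeasure lebesgue (\<Union>v\<in>F. cell v)
    \<le> ennreal (2 * C1 * C2 * (2 * \<epsilon>) powr r) * emeasure lebesgue (cell (node (Suc j) z0))" .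
qed (auto simp: cell_sets)

text \<open>The stopping-time selection for \<open>Q\<close>. Ancestors are reached through points: those of \<open>v\<close> are the
nodes of earlier generations at the points of its cell.\<close>

definition first :: "(nat \<times> 'i \<Rightarrow> bool) \<Rightarrow> (nat \<times> 'i) set" where
  "first Q = {v. Q v \<and> (\<forall>z\<in>cell v. \<forall>j<fst v. \<not> Q (node j z))}"

lemma disjoint_first: "disjoint_family_on cell (first Q)"
proof -
  have "v = w" if "v \<in> first Q" "w \<in> first Q" "z \<in> cell v" "z \<in> cell w" for v w z
  proof -
    have v: "node (fst v) z = v" and w: "node (fst w) z = w"
      using in_cellD that(3,4) by auto
    have "\<not> fst v < fst w" using that(1,2,4) v unfolding first_def by fastforce
    moreover have "\<not> fst w < fst v" using that(1,2,3) w unfolding first_def by fastforce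
    ultimately have "fst v = fst w" by simp
    then show ?thesis using v w by metis
  qed
  then show ?thesis unfolding disjoint_family_on_def by blast
qed

lemma first_ex:
  assumes "Q (node k z)"
  obtains j where "j \<le> k" "node j z \<in> first Q"
proof -
  define j where "j = (LEAST j. Q (node j z))"
  have 1: "Q (node j z)" unfolding j_def using assms by (rule LeastI)
  have 2: "j \<le> k" unfolding j_def using assms by (rule Least_le)
  have "\<not> Q (node i z')" if "z' \<in> cell (node j z)" "i < j" for i z'
  proof -
    have "node j z' = node j z" using that(1) by (simp add: in_cell_iff)
    then have "node i z' = node i z" using that(2) by (intro node_le[of i j]) auto
    moreover have "\<not> Q (node i z)" using that(2) unfolding j_def by (rule not_less_Least)
    ultimately show ?thesis by simp
  qed
  then have "node j z \<in> first Q" using 1 by (auto simp: first_def node_def)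
  with 2 show ?thesis by (rule that)
qed

text \<open>Each first node above level \<open>h\<close> has a parent whose constant is still at most \<open>c0 + h\<close>. Either the parent
is bad, and then the whole cell is, or \<open>high_descends\<close> applies to the parent and bounds the part of
\<open>high (2 * h)\<close> in the cell that is not bad by a small multiple of
the cell. The cells of the first nodes are disjoint and fill \<open>high h\<close>, so these bounds add up.\<close>

lemma good_lambda:
  assumes h: "0 < h" and e: "0 < \<epsilon>" and e2: "(2 * \<epsilon>) powr r \<le> 1 / 2"
  shows "emeasure lebesgue (high (2 * h)) \<le> ennreal (C2 * N / (\<epsilon> * h) powr q)
    + ennreal (2 * C1 * C2 * (2 * \<epsilon>) powr r) * emeasure lebesgue (high h)"
proof -
  define Q where "Q v \<longleftrightarrow> v \<in> nodes \<and> c v > c0 + h" for v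
  \<comment> \<open>the nodes that raise a point of the cell of \<open>v\<close> above level \<open>2 * h\<close> without being bad\<close>
  define V where "V v = {node m z |m z. z \<in> X \<and> node (fst v) z = v \<and> fst v \<le> m \<and>
      c (node m z) > c0 + 2 * h \<and> a (node m z) \<le> \<epsilon> * h}" for v
  define W where "W v = (\<Union>w\<in>V v. cell w) - bad (\<epsilon> * h)" for v
  let ?K = "ennreal (2 * C1 * C2 * (2 * \<epsilon>) powr r)"
  have UVs: "(\<Union>w\<in>V v. cell w) \<in> sets lebesgue" for v
    by (intro sets.countable_UN') (auto simp: cell_sets)
  have Ws: "W v \<in> sets lebesgue" for v
    unfolding W_def using UVs bad_sets by (intro sets.Diff)
  have W_cell: "W v \<subseteq> cell v" for v
  proof -
    have "cell w \<subseteq> cell v" if w: "w \<in> V v" for w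
    proof -
      obtain m z where "w = node m z" "node (fst v) z = v" "fst v \<le> m"
        using w unfolding V_def by blast
      then show ?thesis using cell_antimono[of "fst v" m z] by simp
    qed
    then show ?thesis unfolding W_def by blast
  qed
  have W_le: "emeasure lebesgue (W v) \<le> ?K * emeasure lebesgue (cell v)" if v: "v \<in> first Q" for v
  proof -
    have Qv: "Q v" and nQ: "\<And>z i. z \<in> cell v \<Longrightarrow> i < fst v \<Longrightarrow> \<not> Q (node i z)"
      using v by (auto simp: first_def)
    obtain z0 k where z0: "z0 \<in> X" "v = node k z0" using Qv nodesE unfolding Q_def by blast
    \<comment> \<open>the root rectangle has the constant \<open>c0\<close> itself, so every first node has a parent\<close>
    have "k \<noteq> 0"
    proof
      assume "k = 0"
      then show False using c_root[OF z0(1)] Qv z0 h by (auto simp: Q_def)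
    qed
    then obtain j where k: "k = Suc j" by (cases k) auto
    have "\<not> Q (node j z0)" using nQ[of z0 j] in_cell_node[of z0 k] z0 k by (simp add: node_def)
    then have cu: "c (node j z0) \<le> c0 + h" using node_in_nodes[OF z0(1)] by (auto simp: Q_def)
    show ?thesis
    proof (cases "a (node j z0) \<le> \<epsilon> * h")
      case False
      have "cell v \<subseteq> cell (node j z0)" unfolding z0 k by (rule cell_antimono) simp
      also have "\<dots> \<subseteq> bad (\<epsilon> * h)"
        using False node_in_nodes[OF z0(1), of j] unfolding bad_def by auto
      finally have "W v = {}" using W_cell[of v] by (auto simp: W_def)
      then show ?thesis by simp
    next
      case True
      have fv: "fst v = Suc j" using z0 k by (simp add: node_def)
      have "V v \<subseteq> {node m z |m z. z \<in> X \<and> node j z = node j z0 \<and> j < m \<and>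
        c (node m z) > c0 + 2 * h \<and> a (node m z) \<le> \<epsilon> * h}"
      proof
        fix w assume "w \<in> V v"
        then obtain m z where w: "w = node m z" "z \<in> X" "node (Suc j) z = v" "Suc j \<le> m"
          "c (node m z) > c0 + 2 * h" "a (node m z) \<le> \<epsilon> * h"
          unfolding V_def fv by blast
        have "node j z = node j z0" using w(3) z0(2) k by (intro node_le[of j "Suc j"]) auto
        then show "w \<in> {node m z |m z. z \<in> X \<and> node j z = node j z0 \<and> j < m \<and>
          c (node m z) > c0 + 2 * h \<and> a (node m z) \<le> \<epsilon> * h}"
          using w by (intro CollectI exI[of _ m] exI[of _ z]) simp
      qed
      from high_descends[OF h e e2 z0(1) cu True this]
      have "emeasure lebesgue (\<Union>w\<in>V v. cell w) \<le> ?K * emeasure lebesgue (cell v)"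
        unfolding z0 k .
      moreover have "emeasure lebesgue (W v) \<le> emeasure lebesgue (\<Union>w\<in>V v. cell w)"
        using UVs by (intro emeasure_mono) (auto simp: W_def)
      ultimately show ?thesis by (rule order_trans[rotated])
    qed
  qed
  have cover: "high (2 * h) \<subseteq> bad (\<epsilon> * h) \<union> (\<Union>v\<in>first Q. W v)"
  proof
    fix z assume z: "z \<in> high (2 * h)"
    show "z \<in> bad (\<epsilon> * h) \<union> (\<Union>v\<in>first Q. W v)"
    proof (cases "z \<in> bad (\<epsilon> * h)")
      case False
      obtain w where w: "w \<in> nodes" "c w > c0 + 2 * h" "z \<in> cell w"
        using z unfolding high_def by blast
      obtain x m where x: "x \<in> X" "w = node m x" using w(1) nodesE by blast
      have wz: "node m z = node m x" using w(3) unfolding x by (simp add: in_cell_iff)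
      have "Q (node m z)" using w h wz x by (simp add: Q_def)
      then obtain k where k: "k \<le> m" "node k z \<in> first Q" by (rule first_ex)
      have kx: "node k x = node k z" using node_le[OF k(1), of z x] wz by simp
      have "\<not> a w > \<epsilon> * h" using False w unfolding bad_def by blast
      then have "w \<in> V (node k z)"
        unfolding V_def using x w k(1) kx by (auto simp: node_def)
      then have "z \<in> W (node k z)" using False w(3) by (auto simp: W_def)
      then show ?thesis using k(2) by blast
    qed simp
  qed
  have "disjoint_family_on W (first Q)"
    using disjoint_first[of Q] W_cell unfolding disjoint_family_on_def by blast
  then have "emeasure lebesgue (\<Union>v\<in>first Q. W v) = (\<integral>\<^sup>+v. emeasure lebesgue (W v) \<partial>count_space (first Q))"
    using Ws by (intro emeasure_UN_countable) auto
  also have "\<dots> \<le> (\<integral>\<^sup>+v. ?K * emeasure lebesgue (cell v) \<partial>count_space (first Q))"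
    using W_le by (intro nn_integral_mono) auto
  also have "\<dots> = ?K * (\<integral>\<^sup>+v. emeasure lebesgue (cell v) \<partial>count_space (first Q))"
    by (rule nn_integral_cmult) auto
  also have "(\<integral>\<^sup>+v. emeasure lebesgue (cell v) \<partial>count_space (first Q)) = emeasure lebesgue (\<Union>v\<in>first Q. cell v)"
    using disjoint_first cell_sets by (intro emeasure_UN_countable[symmetric]) auto
  also have "\<dots> \<le> emeasure lebesgue (high h)"
    using high_sets by (intro emeasure_mono) (auto simp: high_def first_def Q_def)
  finally have 1: "emeasure lebesgue (\<Union>v\<in>first Q. W v) \<le> ?K * emeasure lebesgue (high h)"
    by (simp add: mult_left_mono)
  have "emeasure lebesgue (high (2 * h)) \<le> emeasure lebesgue (bad (\<epsilon> * h) \<union> (\<Union>v\<in>first Q. W v))"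
    using cover bad_sets Ws by (intro emeasure_mono sets.Un sets.countable_UN') auto
  also have "\<dots> \<le> emeasure lebesgue (bad (\<epsilon> * h)) + emeasure lebesgue (\<Union>v\<in>first Q. W v)"
    using bad_sets Ws by (intro emeasure_subadditive sets.countable_UN') auto
  also have "\<dots> \<le> ennreal (C2 * N / (\<epsilon> * h) powr q) + ?K * emeasure lebesgue (high h)"
    using h e by (intro add_mono 1 emeasure_bad) auto
  finally show ?thesis .
qed

text \<open>A substitute for the Lebesgue density theorem. In each cell that meets the set \<open>G\<close> in question both the
constant and the oscillation are small, so \<open>G\<close> fills at most half of the cell. If an open set
contains \<open>G\<close> and exceeds it by \<open>\<delta>\<close> in measure, the maximal cells inside it that meet \<open>X\<close> cover \<open>G\<close> and yield
\<open>\<bar>G\<bar> \<le> (\<bar>G\<bar> + \<delta>) / 2\<close>.\<close>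

lemma level_set_minus_high_bad_null:
  assumes h: "0 < h" and e: "0 < \<epsilon>" and e1: "C1 * \<epsilon> powr r \<le> 1 / 2"
  shows "emeasure lebesgue ({z \<in> X. f z > c0 + 2 * h} - high h - bad (\<epsilon> * h)) = 0"
proof -
  define G where "G = {z \<in> X. f z > c0 + 2 * h} - high h - bad (\<epsilon> * h)"
  have Gs: "G \<in> sets lebesgue"
    unfolding G_def by (intro sets.Diff f_sets X_sets X_P0 high_sets bad_sets)
  have Gfin: "emeasure lebesgue G < \<infinity>"
  proof -
    have "emeasure lebesgue G \<le> emeasure lebesgue P0"
      using X_P0 P0_sets by (intro emeasure_mono) (auto simp: G_def)
    then show ?thesis using P0_finite by (rule le_less_trans)
  qed
  have half: "emeasure lebesgue (G \<inter> cell v) \<le> ennreal (1/2) * emeasure lebesgue (cell v)"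
    if v: "v \<in> nodes" and ne: "G \<inter> cell v \<noteq> {}" for v
  proof -
    obtain x k where x: "x \<in> X" "v = node k x" using v nodesE by blast
    have cv: "c v \<le> c0 + h" and av: "a v \<le> \<epsilon> * h"
      using ne v unfolding G_def high_def bad_def by fastforce+
    have "G \<inter> cell v \<subseteq> {z \<in> Up v. f z - c v > h}"
      using X_Up[OF v] cv by (auto simp: G_def)
    moreover have "{z \<in> Up v. f z - c v > h} \<in> sets lebesgue"
      using Up_P P_P0[OF v] by (intro f_diff_sets Up_sets) blast
    ultimately have "emeasure lebesgue (G \<inter> cell v) \<le> emeasure lebesgue {z \<in> Up v. f z - c v > h}"
      by (rule emeasure_mono)
    also have "\<dots> \<le> ennreal ((a v / h) powr r) * emeasure lebesgue (Up v)"
      using v h by (rule osc_Up)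
    also have "\<dots> \<le> ennreal (\<epsilon> powr r) * (ennreal C1 * emeasure lebesgue (cell v))"
    proof (intro mult_mono ennreal_leI powr_mono2)
      show "a v / h \<le> \<epsilon>" using av h by (simp add: field_simps)
      have "emeasure lebesgue (Up v) \<le> ennreal C1 * emeasure lebesgue (cell (node (Suc k) x))"
        using Up_cell[OF x(1)] x(2) by simp
      also have "\<dots> \<le> ennreal C1 * emeasure lebesgue (cell v)"
        using cell_antimono[of k "Suc k" x] x(2) cell_sets by (intro mult_left_mono emeasure_mono) auto
      finally show "emeasure lebesgue (Up v) \<le> ennreal C1 * emeasure lebesgue (cell v)" .
    qed (use a_nonneg[OF v] h const_pos in auto)
    also have "\<dots> = ennreal (C1 * \<epsilon> powr r) * emeasure lebesgue (cell v)"
      using const_pos by (simp add: ennreal_mult mult_ac)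
    also have "\<dots> \<le> ennreal (1/2) * emeasure lebesgue (cell v)"
      using e1 by (intro mult_right_mono ennreal_leI) auto
    finally show ?thesis .
  qed
  have small: "emeasure lebesgue G \<le> ennreal \<delta>" if d: "0 < \<delta>" for \<delta>
  proof -
    obtain T where T: "open T" "G \<subseteq> T" "T - G \<in> lmeasurable" "emeasure lebesgue (T - G) < ennreal \<delta>"
      using sets_lebesgue_outer_open[OF Gs d] by blast
    \<comment> \<open>the first nodes for this property have the maximal cells inside \<open>T\<close>\<close>
    define Q where "Q v \<longleftrightarrow> v \<in> nodes \<and> cell v \<subseteq> T" for v
    have Ts: "T \<in> sets lebesgue" using T(1) by simp
    have cover: "G = (\<Union>v\<in>first Q. G \<inter> cell v)"
    proof -
      have "\<exists>v\<in>first Q. z \<in> cell v" if z: "z \<in> G" for z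
      proof -
        obtain k where "cell (node k z) \<subseteq> T" using cells_shrink[OF T(1)] T(2) z by blast
        then have "Q (node k z)" using node_in_nodes z by (auto simp: Q_def G_def)
        then obtain j where "node j z \<in> first Q" by (rule first_ex)
        then show ?thesis using in_cell_node by blast
      qed
      then show ?thesis by blast
    qed
    have disj: "disjoint_family_on (\<lambda>v. G \<inter> cell v) (first Q)"
      using disjoint_first[of Q] unfolding disjoint_family_on_def by blast
    have "emeasure lebesgue G = emeasure lebesgue (\<Union>v\<in>first Q. G \<inter> cell v)"
      using cover by simp
    also have "\<dots> = (\<integral>\<^sup>+v. emeasure lebesgue (G \<inter> cell v) \<partial>count_space (first Q))"
      using disj cell_sets Gs by (intro emeasure_UN_countable) auto
    also have "\<dots> \<le> (\<integral>\<^sup>+v. ennreal (1/2) * emeasure lebesgue (cell v) \<partial>count_space (first Q))"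
    proof (intro nn_integral_mono)
      fix v assume "v \<in> space (count_space (first Q))"
      then have "v \<in> nodes" by (auto simp: first_def Q_def)
      then show "emeasure lebesgue (G \<inter> cell v) \<le> ennreal (1/2) * emeasure lebesgue (cell v)"
        using half by (cases "G \<inter> cell v = {}") auto
    qed
    also have "\<dots> = ennreal (1/2) * (\<integral>\<^sup>+v. emeasure lebesgue (cell v) \<partial>count_space (first Q))"
      by (rule nn_integral_cmult) auto
    also have "(\<integral>\<^sup>+v. emeasure lebesgue (cell v) \<partial>count_space (first Q)) = emeasure lebesgue (\<Union>v\<in>first Q. cell v)"
      using disjoint_first cell_sets by (intro emeasure_UN_countable[symmetric]) auto
    also have "\<dots> \<le> emeasure lebesgue T"
      using Ts by (intro emeasure_mono) (auto simp: first_def Q_def)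
    also have "emeasure lebesgue T = emeasure lebesgue (G \<union> (T - G))"
      using T(2) by (simp add: Un_absorb1)
    also have "\<dots> \<le> emeasure lebesgue G + emeasure lebesgue (T - G)"
      using Gs Ts by (intro emeasure_subadditive) auto
    also have "\<dots> \<le> emeasure lebesgue G + ennreal \<delta>"
      using T(4) by (intro add_left_mono) auto
    finally have 1: "emeasure lebesgue G \<le> ennreal (1/2) * (emeasure lebesgue G + ennreal \<delta>)"
      by (simp add: mult_left_mono)
    then have "emeasure lebesgue G \<le> ennreal (1/2) * ennreal \<delta> + ennreal (1/2) * emeasure lebesgue G"
      by (simp only: distrib_left add.commute)
    then have "emeasure lebesgue G \<le> 2 * (ennreal (1/2) * ennreal \<delta>)"
      using Gfin by (rule ennreal_absorb_half)
    also have "ennreal (1/2) * ennreal \<delta> = ennreal (\<delta> / 2)"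
      using d by (subst ennreal_mult[symmetric]) auto
    also have "2 * ennreal (\<delta> / 2) = ennreal (2 * (\<delta> / 2))"
      using d by (subst ennreal_mult) auto
    finally show ?thesis by simp
  qed
  have "emeasure lebesgue G \<le> 0"
  proof (rule ennreal_le_epsilon)
    fix \<delta> :: real assume "0 < \<delta>"
    then show "emeasure lebesgue G \<le> 0 + ennreal \<delta>" using small[of \<delta>] by simp
  qed
  then show ?thesis by (simp add: G_def)
qed

text \<open>With \<open>\<phi> h = \<bar>high h\<bar>\<close> the good-lambda inequality says that \<open>h powr q * \<phi> h\<close> is at most a constant plus
half of its value at \<open>h / 2\<close>. Iterating towards \<open>0\<close>, where \<open>\<phi>\<close> stays bounded, leaves twice the constant.\<close>

lemma emeasure_high:
  assumes e: "0 < \<epsilon>" and e2: "(2 * \<epsilon>) powr r \<le> 1 / 2"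
    and e3: "2 * C1 * C2 * (2 * \<epsilon>) powr r \<le> 2 powr - q / 2" and h: "0 < h"
  shows "emeasure lebesgue (high h) \<le> ennreal (2 * 2 powr q * (C2 * N / \<epsilon> powr q) / h powr q)"
proof -
  define K where "K = C2 * N / \<epsilon> powr q"
  have K: "0 \<le> K" using const_pos by (simp add: K_def)
  define \<phi> where "\<phi> h = enn2real (emeasure lebesgue (high h))" for h
  define M where "M = enn2real (ennreal C2 * emeasure lebesgue P0)"
  have Mfin: "ennreal C2 * emeasure lebesgue P0 < \<infinity>"
    using P0_finite by (simp add: ennreal_mult_less_top)
  have le: "emeasure lebesgue (high h) \<le> ennreal C2 * emeasure lebesgue P0" for h
    unfolding high_def by (rule emeasure_cells_finite) auto
  have \<phi>: "emeasure lebesgue (high h) = ennreal (\<phi> h)" for h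
    unfolding \<phi>_def using le[of h] Mfin by (intro ennreal_enn2real[symmetric]) (auto intro: le_less_trans)
  have \<phi>M: "\<phi> h \<le> M" for h
    unfolding \<phi>_def M_def using le Mfin by (intro enn2real_mono) auto
  have \<phi>0: "0 \<le> \<phi> h" for h by (simp add: \<phi>_def)
  have step: "(2 * h) powr q * \<phi> (2 * h) \<le> 2 powr q * K + h powr q * \<phi> h / 2" if h: "0 < h" for h
  proof -
    let ?d = "2 * C1 * C2 * (2 * \<epsilon>) powr r"
    have d0: "0 \<le> ?d" using const_pos by simp
    have "ennreal (\<phi> (2 * h)) \<le> ennreal (C2 * N / (\<epsilon> * h) powr q) + ennreal ?d * ennreal (\<phi> h)"
      using good_lambda[OF h e e2] by (simp add: \<phi>)
    also have "\<dots> = ennreal (C2 * N / (\<epsilon> * h) powr q + ?d * \<phi> h)"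
      using d0 \<phi>0 const_pos by (simp add: ennreal_mult[symmetric] ennreal_plus[symmetric] del: ennreal_plus)
    finally have "\<phi> (2 * h) \<le> C2 * N / (\<epsilon> * h) powr q + ?d * \<phi> h"
      using d0 \<phi>0 const_pos by (subst (asm) ennreal_le_iff) auto
    also have "\<dots> \<le> K / h powr q + 2 powr - q / 2 * \<phi> h"
      using e3 \<phi>0 e h by (intro add_mono mult_right_mono) (auto simp: K_def powr_mult)
    finally have "(2 * h) powr q * \<phi> (2 * h) \<le> (2 * h) powr q * (K / h powr q + 2 powr - q / 2 * \<phi> h)"
      by (intro mult_left_mono) auto
    also have "\<dots> = 2 powr q * K + h powr q * \<phi> h / 2"
      using h by (simp add: powr_mult powr_minus field_simps)
    finally show ?thesis .
  qed
  have bound: "h powr q * \<phi> h \<le> 2 * 2 powr q * K + (1/2)^m * (h powr q * M)" if "0 < h" for h m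
    using that
  proof (induction m arbitrary: h)
    case 0
    have "h powr q * \<phi> h \<le> h powr q * M" by (intro mult_left_mono \<phi>M) auto
    then show ?case using K by (simp add: add_increasing)
  next
    case (Suc m)
    have "h powr q * \<phi> h \<le> 2 powr q * K + (h/2) powr q * \<phi> (h/2) / 2"
      using step[of "h/2"] Suc.prems by simp
    also have "\<dots> \<le> 2 powr q * K + (2 * 2 powr q * K + (1/2)^m * ((h/2) powr q * M)) / 2"
      using Suc.IH[of "h/2"] Suc.prems by simp
    also have "\<dots> \<le> 2 powr q * K + (2 * 2 powr q * K + (1/2)^m * (h powr q * M)) / 2"
      using Suc.prems const_pos \<phi>M[of h] \<phi>0[of h]
      by (intro add_left_mono divide_right_mono mult_left_mono mult_right_mono powr_mono2) auto
    finally show ?case by (simp add: field_simps)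
  qed
  have "(\<lambda>m. 2 * 2 powr q * K + (1/2)^m * (h powr q * M)) \<longlonglongrightarrow> 2 * 2 powr q * K + 0 * (h powr q * M)"
    by (intro tendsto_intros) auto
  then have "h powr q * \<phi> h \<le> 2 * 2 powr q * K"
    using bound[OF h] by (intro LIMSEQ_le_const) auto
  then have "\<phi> h \<le> 2 * 2 powr q * K / h powr q"
    using h by (simp add: field_simps)
  then show ?thesis unfolding \<phi> K_def by (rule ennreal_leI)
qed

theorem weak_type:
  assumes \<mu>: "0 < \<mu>"
  shows "emeasure lebesgue {z \<in> X. f z - c0 > \<mu>} \<le> ennreal (weak_const C1 C2 q r * N / \<mu> powr q)"
proof -
  define tl where "tl = tolerance C1 C2 q r"
  have C: "1 \<le> C1 * C2" using const_pos mult_mono[of 1 C1 1 C2] by simp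
  have t0: "0 < tl"
  proof -
    have "0 < C1" "0 < C2" using const_pos by linarith+
    then show ?thesis by (simp add: tl_def tolerance_def)
  qed
  have t: "(2 * tl) powr r = 2 powr - q / (4 * C1 * C2)"
    using const_pos by (simp add: tl_def tolerance_def powr_powr)
  have q1: "2 powr - q \<le> (1::real)" using const_pos powr_mono[of "-q" 0 2] by simp
  have e2: "(2 * tl) powr r \<le> 1 / 2"
    unfolding t using C q1 by (simp add: field_simps)
  have e3: "2 * C1 * C2 * (2 * tl) powr r \<le> 2 powr - q / 2"
    unfolding t using const_pos by simp
  have "C1 * tl powr r \<le> C1 * (2 * tl) powr r"
    using const_pos t0 by (intro mult_left_mono powr_mono2) auto
  also have "\<dots> \<le> 1/2"
    unfolding t using const_pos q1 by (simp add: field_simps)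
  finally have e1: "C1 * tl powr r \<le> 1 / 2" .
  \<comment> \<open>the level set of \<open>f\<close> at \<open>2 * h\<close> is compared with \<open>high h\<close>\<close>
  define h where "h = \<mu> / 2"
  have h: "0 < h" using \<mu> by (simp add: h_def)
  let ?L = "{z \<in> X. f z > c0 + 2 * h}"
  have eq: "{z \<in> X. f z - c0 > \<mu>} = ?L" by (auto simp: h_def)
  have HB: "high h \<union> bad (tl * h) \<in> sets lebesgue" by (intro sets.Un high_sets bad_sets)
  have rest: "?L - high h - bad (tl * h) \<in> sets lebesgue"
    by (intro sets.Diff f_sets(1) X_sets X_P0 high_sets bad_sets)
  have "emeasure lebesgue ?L \<le> emeasure lebesgue ((high h \<union> bad (tl * h)) \<union> (?L - high h - bad (tl * h)))"
    by (rule emeasure_mono[OF _ sets.Un[OF HB rest]]) blast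
  also have "\<dots> \<le> emeasure lebesgue (high h \<union> bad (tl * h)) + emeasure lebesgue (?L - high h - bad (tl * h))"
    by (rule emeasure_subadditive[OF HB rest])
  also have "\<dots> = emeasure lebesgue (high h \<union> bad (tl * h))"
    using level_set_minus_high_bad_null[OF h t0 e1] by simp
  also have "\<dots> \<le> emeasure lebesgue (high h) + emeasure lebesgue (bad (tl * h))"
    using high_sets bad_sets by (intro emeasure_subadditive)
  also have "\<dots> \<le> ennreal (2 * 2 powr q * (C2 * N / tl powr q) / h powr q) + ennreal (C2 * N / (tl * h) powr q)"
    by (intro add_mono emeasure_high[OF t0 e2 e3 h] emeasure_bad mult_pos_pos t0 h)
  also have "\<dots> = ennreal (2 * 2 powr q * (C2 * N / tl powr q) / h powr q + C2 * N / (tl * h) powr q)"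
    using const_pos by (intro ennreal_plus[symmetric]) auto
  also have "2 * 2 powr q * (C2 * N / tl powr q) / h powr q + C2 * N / (tl * h) powr q
     = weak_const C1 C2 q r * N / \<mu> powr q"
  proof -
    have hq: "h powr q = \<mu> powr q / 2 powr q" "(tl * h) powr q = tl powr q * h powr q"
      using t0 h \<mu> by (simp_all add: h_def powr_divide powr_mult)
    have "2 * u * (C2 * N / v) / (w / u) + C2 * N / (v * (w / u)) = u * (2 * u + 1) * C2 / v * N / w"
      if "0 < u" "0 < v" "0 < w" for u v w :: real
      using that by (simp add: field_simps)
    from this[of "2 powr q" "tl powr q" "\<mu> powr q"] show ?thesis
      using t0 \<mu> unfolding hq weak_const_def tl_def[symmetric] by simp
  qed
  finally show ?thesis using eq by simp
qed

end

section \<open>Parabolic boxes\<close>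

text \<open>With \<open>\<sigma> = 1\<close> the upper part of the rectangle, with \<open>\<sigma> = -1\<close> the lower part, and with lag \<open>g = -1\<close>
the whole rectangle. Reversing time changes only the sign.\<close>

definition signed_part :: "real \<Rightarrow> real \<Rightarrow> real \<Rightarrow> real^'n \<Rightarrow> real \<Rightarrow> real \<Rightarrow> ((real^'n) \<times> real) set" where
  "signed_part p \<sigma> g x t L = cube x L \<times> {s. g * L powr p < \<sigma> * (s - t) \<and> \<sigma> * (s - t) < L powr p}"

lemma prect_upper_eq_signed_part: "prect_upper p g x t L = signed_part p 1 g x t L"
  by (auto simp: prect_upper_def signed_part_def algebra_simps)

lemma prect_lower_eq_signed_part: "prect_lower p g x t L = signed_part p (-1) g x t L"
  by (auto simp: prect_lower_def signed_part_def algebra_simps)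

lemma prect_eq_signed_part: "\<sigma> = 1 \<or> \<sigma> = -1 \<Longrightarrow> prect p x t L = signed_part p \<sigma> (-1) x t L"
  by (auto simp: prect_def signed_part_def algebra_simps)

text \<open>Half of the volume of the rectangle with edge length \<open>L\<close> in space dimension \<open>n\<close>.\<close>

definition rect_vol :: "nat \<Rightarrow> real \<Rightarrow> real \<Rightarrow> real" where
  "rect_vol n p L = (2 * L) ^ n * L powr p"

lemma cube_eq_cbox: "cube x L = cbox (\<chi> i. x $ i - L) (\<chi> i. x $ i + L)"
  by (auto simp: cube_def mem_box_cart abs_le_iff algebra_simps)

lemma emeasure_cube:
  fixes x :: "real^'n"
  assumes "0 \<le> L"
  shows "emeasure lborel (cube x L) = ennreal ((2 * L) ^ CARD('n))"
proof -
  have "emeasure lborel (cube x L) = ennreal (\<Prod>b\<in>Basis. (((\<chi> i. x $ i + L) :: real^'n) - (\<chi> i. x $ i - L)) \<bullet> b)"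
    unfolding cube_eq_cbox using assms
    by (subst emeasure_lborel_cbox_eq) (auto simp: Basis_vec_def inner_axis)
  also have "(\<Prod>b\<in>Basis. (((\<chi> i. x $ i + L) :: real^'n) - (\<chi> i. x $ i - L)) \<bullet> b) = (\<Prod>b\<in>(Basis::(real^'n) set). 2 * L)"
    by (intro prod.cong) (auto simp: Basis_vec_def inner_axis)
  also have "\<dots> = (2 * L) ^ CARD('n)" by (simp add: DIM_cart)
  finally show ?thesis .
qed

lemma signed_part_borel: "signed_part p \<sigma> g x t L \<in> sets borel"
proof -
  have "open {s. g * L powr p < \<sigma> * (s - t) \<and> \<sigma> * (s - t) < L powr p}"
    by (intro open_Collect_conj open_Collect_less continuous_intros)
  then have "{s. g * L powr p < \<sigma> * (s - t) \<and> \<sigma> * (s - t) < L powr p} \<in> sets borel" by simp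
  moreover have "cube x L \<in> sets borel" unfolding cube_eq_cbox by simp
  ultimately show ?thesis unfolding signed_part_def by (simp add: borel_Times)
qed

lemma signed_part_sets: "signed_part p \<sigma> g x t L \<in> sets lebesgue"
  using signed_part_borel by (metis sets_completionI_sets sets_lborel)

lemma emeasure_signed_part:
  fixes x :: "real^'n"
  assumes "0 \<le> L" "g \<le> 1" and \<sigma>: "\<sigma> = 1 \<or> \<sigma> = -1"
  shows "emeasure lebesgue (signed_part p \<sigma> g x t L) = ennreal ((1 - g) * rect_vol CARD('n) p L)"
proof -
  let ?I = "{s. g * L powr p < \<sigma> * (s - t) \<and> \<sigma> * (s - t) < L powr p}"
  have g: "g * L powr p \<le> L powr p" using mult_right_mono[OF assms(2), of "L powr p"] by simp
  have I: "emeasure lborel ?I = ennreal ((1 - g) * L powr p)"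
  proof (cases "\<sigma> = 1")
    case True
    have "?I = {t + g * L powr p <..< t + L powr p}" using True by auto
    then show ?thesis using g by (simp add: algebra_simps)
  next
    case False
    then have "?I = {t - L powr p <..< t - g * L powr p}" using \<sigma> by auto
    then show ?thesis using g by (simp add: algebra_simps)
  qed
  have Ib: "?I \<in> sets lborel"
    unfolding sets_lborel by (intro borel_open open_Collect_conj open_Collect_less continuous_intros)
  have "emeasure lebesgue (signed_part p \<sigma> g x t L) = emeasure (lborel \<Otimes>\<^sub>M lborel) (cube x L \<times> ?I)"
    using signed_part_borel[of p \<sigma> g x t L] by (simp add: lborel_prod signed_part_def[symmetric])
  also have "\<dots> = emeasure lborel (cube x L) * emeasure lborel ?I"
    using Ib by (intro lborel.emeasure_pair_measure_Times) (auto simp: cube_eq_cbox)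
  also have "\<dots> = ennreal ((2 * L) ^ CARD('n) * ((1 - g) * L powr p))"
    unfolding I emeasure_cube[OF assms(1)] using assms by (intro ennreal_mult[symmetric]) auto
  finally show ?thesis by (simp add: rect_vol_def mult_ac)
qed

lemma rect_vol_scale:
  assumes "0 \<le> a" "0 \<le> L"
  shows "rect_vol n p (a * L) = a ^ n * a powr p * rect_vol n p L"
  using assms by (simp add: rect_vol_def power_mult_distrib powr_mult)

lemma rect_vol_pos: "0 < L \<Longrightarrow> 0 < rect_vol n p L"
  by (simp add: rect_vol_def)

section \<open>Minimising constants and their oscillation\<close>

definition lag_osc :: "real \<Rightarrow> ((real^'n) \<times> real) set \<Rightarrow> ((real^'n) \<times> real) set \<Rightarrow>
    ((real^'n) \<times> real \<Rightarrow> real) \<Rightarrow> real \<Rightarrow> ennreal" where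
  "lag_osc r A B f c = nn_average A (\<lambda>z. pos_part (f z - c) powr r) +
     nn_average B (\<lambda>z. neg_part (f z - c) powr r)"

lemma lag_osc_as_integral:
  assumes AB: "A \<in> sets lebesgue" "B \<in> sets lebesgue"
    and mA: "emeasure lebesgue A = ennreal a" "0 < a" and mB: "emeasure lebesgue B = ennreal b" "0 < b"
    and f: "f \<in> borel_measurable lebesgue"
  shows "lag_osc r A B f c = (\<integral>\<^sup>+z. ennreal (pos_part (f z - c) powr r * indicat_real A z / a
      + neg_part (f z - c) powr r * indicat_real B z / b) \<partial>lebesgue)"
proof -
  have m1: "(\<lambda>z. ennreal (pos_part (f z - c) powr r) * indicator A z) \<in> borel_measurable lebesgue"
    and m2: "(\<lambda>z. ennreal (neg_part (f z - c) powr r) * indicator B z) \<in> borel_measurable lebesgue"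
    unfolding pos_part_def neg_part_def using f AB by measurable
  have "lag_osc r A B f c = (\<integral>\<^sup>+z. ennreal (pos_part (f z - c) powr r) * indicator A z / ennreal a \<partial>lebesgue)
      + (\<integral>\<^sup>+z. ennreal (neg_part (f z - c) powr r) * indicator B z / ennreal b \<partial>lebesgue)"
    unfolding lag_osc_def nn_average_def mA mB using m1 m2 by (simp add: nn_integral_divide)
  also have "\<dots> = (\<integral>\<^sup>+z. ennreal (pos_part (f z - c) powr r) * indicator A z / ennreal a
      + ennreal (neg_part (f z - c) powr r) * indicator B z / ennreal b \<partial>lebesgue)"
    using m1 m2 by (intro nn_integral_add[symmetric]) auto
  also have "\<dots> = (\<integral>\<^sup>+z. ennreal (pos_part (f z - c) powr r * indicat_real A z / a
      + neg_part (f z - c) powr r * indicat_real B z / b) \<partial>lebesgue)"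
    using mA mB by (intro nn_integral_cong) (auto simp: indicator_def divide_ennreal)
  finally show ?thesis .
qed

text \<open>Take a minimising sequence of constants that converges in the extended reals. If the limit is finite,
Fatou's lemma makes it a minimiser. An infinite limit is impossible unless the infimum is infinite: the
integrand would tend to infinity on all of \<open>B\<close> (for \<open>\<infinity>\<close>) or of \<open>A\<close> (for \<open>-\<infinity>\<close>).\<close>

lemma exists_minimizer_global:
  assumes AB: "A \<in> sets lebesgue" "B \<in> sets lebesgue"
    and mA: "emeasure lebesgue A = ennreal a" "0 < a" and mB: "emeasure lebesgue B = ennreal b" "0 < b"
    and f: "f \<in> borel_measurable lebesgue" and r: "0 < r"
  shows "\<exists>c. \<forall>d. lag_osc r A B f c \<le> lag_osc r A B f d"
proof -
  define w where "w c z = pos_part (f z - c) powr r * indicat_real A z / a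
      + neg_part (f z - c) powr r * indicat_real B z / b" for c z
  have wm: "w c \<in> borel_measurable lebesgue" for c
    unfolding w_def pos_part_def neg_part_def using f AB by measurable
  have G: "lag_osc r A B f c = (\<integral>\<^sup>+z. ennreal (w c z) \<partial>lebesgue)" for c
    unfolding w_def by (rule lag_osc_as_integral[OF AB mA mB f])
  define m where "m = (INF c. lag_osc r A B f c)"
  have m: "m \<le> lag_osc r A B f c" for c unfolding m_def by (rule INF_lower) simp
  show ?thesis
  proof (cases "m = \<infinity>")
    case True
    then have "lag_osc r A B f c = \<infinity>" for c using m[of c] by (simp add: top_unique)
    then show ?thesis by auto
  next
    case False
    obtain g where g: "decseq g" "range g \<subseteq> range (lag_osc r A B f)" "m = (INF i. g i)"
      using ennreal_Inf_countable_INF[of "range (lag_osc r A B f)"] unfolding m_def by auto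
    have "\<forall>n. \<exists>c. g n = lag_osc r A B f c" using g(2) by blast
    then obtain C where C: "\<And>n. g n = lag_osc r A B f (C n)" by metis
    have glim: "g \<longlonglongrightarrow> m" unfolding g(3) using g(1) by (rule LIMSEQ_INF)
    obtain l s where s: "strict_mono s" "((\<lambda>n. ereal (C n)) \<circ> s) \<longlonglongrightarrow> l"
      using compact_complete_linorder[of "\<lambda>n. ereal (C n)"] by blast
    have Cs: "(\<lambda>n. ereal (C (s n))) \<longlonglongrightarrow> l" using s(2) by (simp add: o_def)
    have gs: "(\<lambda>n. g (s n)) \<longlonglongrightarrow> m" using LIMSEQ_subseq_LIMSEQ[OF glim s(1)] by (simp add: o_def)
    have "(\<integral>\<^sup>+z. liminf (\<lambda>n. ennreal (w (C (s n)) z)) \<partial>lebesgue)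
        \<le> liminf (\<lambda>n. \<integral>\<^sup>+z. ennreal (w (C (s n)) z) \<partial>lebesgue)"
      using wm by (intro nn_integral_liminf) auto
    also have "\<dots> = liminf (\<lambda>n. g (s n))" by (simp add: G C)
    also have "\<dots> = m" using gs by (intro lim_imp_Liminf) auto
    finally have fatou: "(\<integral>\<^sup>+z. liminf (\<lambda>n. ennreal (w (C (s n)) z)) \<partial>lebesgue) \<le> m" .
    have noinf: False if E: "E \<in> sets lebesgue" "emeasure lebesgue E > 0"
      and top: "\<And>z. z \<in> E \<Longrightarrow> filterlim (\<lambda>n. w (C (s n)) z) at_top sequentially" for E
    proof -
      have "liminf (\<lambda>n. ennreal (w (C (s n)) z)) = \<infinity>" if "z \<in> E" for z
        using top[OF that] ennreal_tendsto_top_eq_at_top[of "\<lambda>n. w (C (s n)) z"]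
        by (intro lim_imp_Liminf) auto
      then have "(\<integral>\<^sup>+z. \<infinity> * indicator E z \<partial>lebesgue) \<le> (\<integral>\<^sup>+z. liminf (\<lambda>n. ennreal (w (C (s n)) z)) \<partial>lebesgue)"
        by (intro nn_integral_mono) (auto simp: indicator_def)
      moreover have "(\<integral>\<^sup>+z. \<infinity> * indicator E z \<partial>lebesgue) = \<infinity>"
        using E by (subst nn_integral_cmult_indicator) (auto simp: ennreal_top_mult)
      ultimately show False using fatou False by (auto simp: top_unique)
    qed
    have pw: "filterlim (\<lambda>n. u n powr r / k) at_top sequentially"
      if "filterlim u at_top sequentially" "0 < k" for u :: "nat \<Rightarrow> real" and k
    proof -
      have "filterlim (\<lambda>x::real. x powr r) at_top at_top" unfolding filterlim_at_top
      proof
        fix Z :: real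
        have "Z \<le> x powr r" if x: "max Z 1 powr (1 / r) \<le> x" for x
        proof -
          have "Z \<le> max Z 1" by simp
          also have "\<dots> = (max Z 1 powr (1 / r)) powr r" using r by (simp add: powr_powr)
          also have "\<dots> \<le> x powr r" using r x by (intro powr_mono2) auto
          finally show ?thesis .
        qed
        then show "\<forall>\<^sub>F x in at_top. Z \<le> x powr r"
          using eventually_ge_at_top by (rule eventually_mono[rotated])
      qed
      then have "filterlim (\<lambda>n. u n powr r) at_top sequentially" using that(1) by (rule filterlim_compose)
      then show ?thesis
        using filterlim_tendsto_pos_mult_at_top[OF tendsto_const, of "1/k" "\<lambda>n. u n powr r" sequentially] that(2)
        by simp
    qed
    consider "l = \<infinity>" | "l = -\<infinity>" | c where "l = ereal c" by (cases l) auto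
    then show ?thesis
    proof cases
      case 1
      then have C: "filterlim (\<lambda>n. C (s n)) at_top sequentially" using Cs by (simp add: tendsto_PInfty_eq_at_top)
      have "filterlim (\<lambda>n. w (C (s n)) z) at_top sequentially" if "z \<in> B" for z
      proof (rule filterlim_at_top_mono)
        have "filterlim (\<lambda>n. neg_part (f z - C (s n))) at_top sequentially"
        proof (rule filterlim_at_top_mono)
          show "filterlim (\<lambda>n. - f z + C (s n)) at_top sequentially"
            using C by (intro filterlim_tendsto_add_at_top[OF tendsto_const])
        qed (simp add: neg_part_def min_def)
        then show "filterlim (\<lambda>n. neg_part (f z - C (s n)) powr r / b) at_top sequentially"
          using mB(2) by (rule pw)
        show "\<forall>\<^sub>F n in sequentially. neg_part (f z - C (s n)) powr r / b \<le> w (C (s n)) z"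
          using that mA by (auto simp: w_def)
      qed
      then have False using AB mB by (intro noinf[of B]) auto
      then show ?thesis ..
    next
      case 2
      then have C: "filterlim (\<lambda>n. - C (s n)) at_top sequentially"
        using tendsto_uminus_ereal[OF Cs] by (simp add: tendsto_PInfty_eq_at_top)
      have "filterlim (\<lambda>n. w (C (s n)) z) at_top sequentially" if "z \<in> A" for z
      proof (rule filterlim_at_top_mono)
        have "filterlim (\<lambda>n. pos_part (f z - C (s n))) at_top sequentially"
        proof (rule filterlim_at_top_mono)
          show "filterlim (\<lambda>n. f z + - C (s n)) at_top sequentially"
            using C by (intro filterlim_tendsto_add_at_top[OF tendsto_const])
        qed (simp add: pos_part_def)
        then show "filterlim (\<lambda>n. pos_part (f z - C (s n)) powr r / a) at_top sequentially"
          using mA(2) by (rule pw)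
        show "\<forall>\<^sub>F n in sequentially. pos_part (f z - C (s n)) powr r / a \<le> w (C (s n)) z"
          using that mB by (auto simp: w_def)
      qed
      then have False using AB mA by (intro noinf[of A]) auto
      then show ?thesis ..
    next
      case (3 c)
      then have C: "(\<lambda>n. C (s n)) \<longlonglongrightarrow> c" using Cs by simp
      have "(\<lambda>n. w (C (s n)) z) \<longlonglongrightarrow> w c z" for z
        unfolding w_def pos_part_def neg_part_def using C r mA mB
        by (intro tendsto_intros tendsto_powr2) auto
      then have "liminf (\<lambda>n. ennreal (w (C (s n)) z)) = ennreal (w c z)" for z
        by (intro lim_imp_Liminf tendsto_ennrealI) auto
      then have "lag_osc r A B f c \<le> m" using fatou by (simp add: G)
      then show ?thesis using m by (meson order_trans)
    qed
  qed
qed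

lemma nn_average_cong:
  "(\<And>z. z \<in> A \<Longrightarrow> g z = h z) \<Longrightarrow> nn_average A g = nn_average A h"
  unfolding nn_average_def by (intro arg_cong2[where f="(/)"] nn_integral_cong refl) (auto simp: indicator_def)

lemma exists_minimizer:
  assumes AB: "A \<in> sets lebesgue" "B \<in> sets lebesgue" "A \<subseteq> S" "B \<subseteq> S" and S: "S \<in> sets lebesgue"
    and mA: "emeasure lebesgue A = ennreal a" "0 < a" and mB: "emeasure lebesgue B = ennreal b" "0 < b"
    and f: "f \<in> borel_measurable (lebesgue_on S)" and r: "0 < r"
  shows "\<exists>c. \<forall>d. lag_osc r A B f c \<le> lag_osc r A B f d"
proof -
  define f' where "f' z = (if z \<in> S then f z else 0)" for z
  have f': "f' \<in> borel_measurable lebesgue"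
    unfolding f'_def using f S by (simp add: borel_measurable_if)
  have "lag_osc r A B f = lag_osc r A B f'"
    unfolding lag_osc_def fun_eq_iff using AB
    by (intro allI arg_cong2[where f="(+)"] nn_average_cong) (auto simp: f'_def)
  then show ?thesis using exists_minimizer_global[OF AB(1,2) mA mB f' r] by simp
qed

text \<open>Markov's inequality for the \<open>r\<close>-th power. The function is extended by zero from \<open>S\<close> to get
measurability on the whole space.\<close>

lemma weak_type_average:
  assumes A: "A \<in> sets lebesgue" "A \<subseteq> S" and S: "S \<in> sets lebesgue"
    and mA: "emeasure lebesgue A = ennreal m" "0 < m"
    and f: "f \<in> borel_measurable (lebesgue_on S)" and r: "0 < r"
    and av: "nn_average A (\<lambda>z. max (\<sigma> * (f z - c)) 0 powr r) \<le> ennreal (a powr r)" and a: "0 \<le> a" and h: "0 < h"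
  shows "emeasure lebesgue {z \<in> A. \<sigma> * (f z - c) > h} \<le> ennreal ((a / h) powr r) * emeasure lebesgue A"
proof -
  define f' where "f' z = (if z \<in> S then f z else 0)" for z
  have f': "f' \<in> borel_measurable lebesgue"
    unfolding f'_def using f S by (simp add: borel_measurable_if)
  let ?u = "\<lambda>z. ennreal (max (\<sigma> * (f' z - c)) 0 powr r)"
  let ?k = "ennreal (1 / h powr r)"
  have u: "(\<lambda>z. ?u z * indicator A z) \<in> borel_measurable lebesgue" using f' A by measurable
  have eq: "{z \<in> A. 1 \<le> ?k * ?u z} = A \<inter> {z \<in> space lebesgue. 1 \<le> ?k * ?u z}" by auto
  have "{z \<in> space lebesgue. 1 \<le> ?k * ?u z} \<in> sets lebesgue" using f' by measurable
  then have s: "{z \<in> A. 1 \<le> ?k * ?u z} \<in> sets lebesgue" unfolding eq by (rule sets.Int[OF A(1)])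
  have "nn_average A (\<lambda>z. max (\<sigma> * (f z - c)) 0 powr r) = nn_average A (\<lambda>z. max (\<sigma> * (f' z - c)) 0 powr r)"
    using A by (intro nn_average_cong) (auto simp: f'_def)
  then have av': "(\<integral>\<^sup>+z. ?u z * indicator A z \<partial>lebesgue) / ennreal m \<le> ennreal (a powr r)"
    using av by (simp add: nn_average_def mA)
  have "(\<integral>\<^sup>+z. ?u z * indicator A z \<partial>lebesgue) = (\<integral>\<^sup>+z. ?u z * indicator A z \<partial>lebesgue) / ennreal m * ennreal m"
    using mA by (simp add: ennreal_divide_times divide_ennreal)
  also have "\<dots> \<le> ennreal (a powr r) * ennreal m" by (intro mult_right_mono av') auto
  finally have I: "(\<integral>\<^sup>+z. ?u z * indicator A z \<partial>lebesgue) \<le> ennreal (a powr r) * ennreal m" .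
  have "{z \<in> A. \<sigma> * (f z - c) > h} \<subseteq> {z \<in> A. 1 \<le> ?k * ?u z}"
  proof clarify
    fix z assume z: "z \<in> A" "\<sigma> * (f z - c) > h"
    then have "h powr r \<le> max (\<sigma> * (f' z - c)) 0 powr r"
      using h r A by (intro powr_mono2) (auto simp: f'_def)
    then have "1 \<le> 1 / h powr r * max (\<sigma> * (f' z - c)) 0 powr r" using h by (simp add: field_simps)
    then have "ennreal 1 \<le> ennreal (1 / h powr r * max (\<sigma> * (f' z - c)) 0 powr r)" by (rule ennreal_leI)
    also have "\<dots> = ?k * ?u z" by (rule ennreal_mult) auto
    finally show "1 \<le> ?k * ?u z" by (simp only: ennreal_1)
  qed
  then have "emeasure lebesgue {z \<in> A. \<sigma> * (f z - c) > h} \<le> emeasure lebesgue {z \<in> A. 1 \<le> ?k * ?u z}"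
    using s by (rule emeasure_mono)
  also have "\<dots> \<le> ?k * (\<integral>\<^sup>+z. ?u z * indicator A z \<partial>lebesgue)"
    using u A by (intro nn_integral_Markov_inequality)
  also have "\<dots> \<le> ?k * (ennreal (a powr r) * ennreal m)" by (intro mult_left_mono I) auto
  also have "\<dots> = ennreal ((a / h) powr r) * emeasure lebesgue A"
    using a h by (simp add: mA mult.assoc[symmetric] ennreal_mult[symmetric] powr_divide)
  finally show ?thesis .
qed

section \<open>A nested tree of parabolic rectangles\<close>

text \<open>Each cell contains a rectangle whose edge length is this multiple of the edge length of its generation.\<close>

definition cell_scale :: "nat \<Rightarrow> real" where
  "cell_scale e = 1 / 2 ^ (e + 4)"

text \<open>The inverse volume ratio for rectangles with edge lengths in proportion \<open>cell_scale e * 2 powr - (b / p)\<close>: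
the factor from one generation to the next times the factor from a rectangle to one inside its cell.\<close>

definition cell_ratio :: "nat \<Rightarrow> real \<Rightarrow> nat \<Rightarrow> nat \<Rightarrow> real" where
  "cell_ratio n p b e = 1 / ((cell_scale e * 2 powr - (real b / p)) ^ n * (cell_scale e * 2 powr - (real b / p)) powr p)"

definition dilation_ratio :: "nat \<Rightarrow> real \<Rightarrow> real \<Rightarrow> real" where
  "dilation_ratio n p \<gamma> = 2 * 5 ^ n * 5 powr p / (1 - \<gamma>)"

text \<open>From one generation to the next the height of the rectangles shrinks by \<open>2 ^ b\<close> and hence the edge length by
\<open>2 powr (b / p)\<close>. The assumptions on \<open>b\<close> make the next rectangle fit between the lags \<open>\<gamma>\<close> and \<open>\<alpha>\<close> and at least
halve the edge. The height of a cell of generation \<open>k\<close> is \<open>tau k / 2 ^ e\<close>, by the choice of \<open>e\<close> at most an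
eighth of the height of the upper part of its rectangle.\<close>

locale parabolic_grid =
  fixes p \<gamma> \<alpha> \<sigma> t L :: real and x :: "real^'n" and b e :: nat
  assumes p: "1 < p" and \<gamma>: "0 \<le> \<gamma>" and \<alpha>: "\<gamma> < \<alpha>" "\<alpha> < 1" and L: "0 < L"
    and \<sigma>: "\<sigma> = 1 \<or> \<sigma> = -1"
    and b: "8 \<le> (\<alpha> - \<gamma>) * 2 ^ b" "p \<le> real b" and e: "8 \<le> (1 - \<gamma>) * 2 ^ e"
begin

text \<open>Time relative to the centre of the ambient rectangle, running backwards if \<open>\<sigma> = -1\<close>.\<close>

definition u :: "(real^'n) \<times> real \<Rightarrow> real" where
  "u z = \<sigma> * (snd z - t)"

definition len :: "nat \<Rightarrow> real" where
  "len k = L * 2 powr - (real (b * k) / p)"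

definition tau :: "nat \<Rightarrow> real" where
  "tau k = L powr p / 2 ^ (b * k)"

text \<open>The common bound for the height of a cell of generation \<open>k\<close> and for \<open>tau (Suc k)\<close>, an eighth of the height of
the upper part of a rectangle.\<close>

definition slack :: "nat \<Rightarrow> real" where
  "slack k = (1 - \<gamma>) / 8 * tau k"

text \<open>The ratio \<open>2 powr (b / p)\<close> of edge lengths need not be an integer, so the edges of nested cells cannot
follow it exactly. Dyadic edges \<open>L / 2 ^ depth k\<close> are used, between a quarter and a half of \<open>len k\<close>.\<close>

definition depth :: "nat \<Rightarrow> nat" where
  "depth k = nat \<lceil>real (b * k) / p\<rceil> + 1"

definition idx :: "nat \<Rightarrow> (real^'n) \<times> real \<Rightarrow> ('n \<Rightarrow> int) \<times> int" where
  "idx k z = ((\<lambda>i. \<lfloor>(fst z $ i - x $ i) / L * 2 ^ depth k\<rfloor>), \<lfloor>u z / L powr p * 2 ^ (b * k + e)\<rfloor>)"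

definition X :: "((real^'n) \<times> real) set" where
  "X = signed_part p \<sigma> \<alpha> x t L"

text \<open>The rectangle of a node is placed according to one point of its cell, so that it is a function of the
node alone; cells are small enough for all their points to be treated alike.\<close>

definition rep :: "nat \<Rightarrow> ('n \<Rightarrow> int) \<times> int \<Rightarrow> (real^'n) \<times> real" where
  "rep k i = (SOME z. z \<in> X \<and> idx k z = i)"

text \<open>The point of the cube nearest to \<open>z\<close> around which a cube with half edge \<open>len k\<close> still fits.\<close>

definition ctr :: "nat \<Rightarrow> (real^'n) \<times> real \<Rightarrow> real^'n" where
  "ctr k z = (\<chi> i. max (x $ i - (L - len k)) (min (x $ i + (L - len k)) (fst z $ i)))"

text \<open>The relative time of the centre. It is chosen to put \<open>z\<close> halfway between the lag \<open>\<gamma>\<close> and the top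
of the rectangle, which are \<open>8 * slack k\<close> apart, unless the rectangle would then stick out of the top of the
ambient one. In generation \<open>0\<close> the rectangle is the ambient one, whatever \<open>z\<close> is.\<close>

definition mid :: "nat \<Rightarrow> (real^'n) \<times> real \<Rightarrow> real" where
  "mid k z = (if k = 0 then 0 else min (u z - (\<gamma> * tau k + 4 * slack k)) (tau 0 - tau k))"

definition box_of :: "nat \<times> (('n \<Rightarrow> int) \<times> int) \<Rightarrow> (real^'n) \<times> real \<times> real" where
  "box_of v = (ctr (fst v) (rep (fst v) (snd v)), t + \<sigma> * mid (fst v) (rep (fst v) (snd v)), len (fst v))"

definition P :: "nat \<times> (('n \<Rightarrow> int) \<times> int) \<Rightarrow> ((real^'n) \<times> real) set" where
  "P v = (case box_of v of (y, s, l) \<Rightarrow> prect p y s l)"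

definition Up :: "nat \<times> (('n \<Rightarrow> int) \<times> int) \<Rightarrow> ((real^'n) \<times> real) set" where
  "Up v = (case box_of v of (y, s, l) \<Rightarrow> signed_part p \<sigma> \<gamma> y s l)"

definition Lo :: "nat \<times> (('n \<Rightarrow> int) \<times> int) \<Rightarrow> ((real^'n) \<times> real) set" where
  "Lo v = (case box_of v of (y, s, l) \<Rightarrow> signed_part p (- \<sigma>) \<gamma> y s l)"

definition Dil :: "nat \<times> (('n \<Rightarrow> int) \<times> int) \<Rightarrow> ((real^'n) \<times> real) set" where
  "Dil v = (case box_of v of (y, s, l) \<Rightarrow> prect p y s (5 * l))"

lemma \<sigma>2: "\<sigma> * (\<sigma> * w) = w" "\<sigma> * \<sigma> = 1" "\<bar>\<sigma>\<bar> = 1"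
  using \<sigma> by auto

lemma len_pos: "0 < len k" and tau_pos: "0 < tau k"
  using L by (simp_all add: len_def tau_def)

lemma len_powr: "len k powr p = tau k"
proof -
  have "len k powr p = L powr p * 2 powr (- (real (b * k) / p) * p)"
    using L by (simp add: len_def powr_mult powr_powr)
  also have "- (real (b * k) / p) * p = - real (b * k)" using p by simp
  finally show ?thesis
    by (simp only: tau_def powr_minus powr_realpow zero_less_numeral divide_inverse)
qed

lemma len_0 [simp]: "len 0 = L" and tau_0: "tau 0 = L powr p"
  by (simp_all add: len_def tau_def)

lemma len_Suc: "len (Suc k) = len k * 2 powr - (real b / p)"
proof -
  have "- (real (b * Suc k) / p) = - (real (b * k) / p) + - (real b / p)"
    by (simp add: distrib_left add_divide_distrib)
  then show ?thesis by (simp only: len_def powr_add mult.assoc)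
qed

lemma len_Suc_le: "len (Suc k) \<le> len k / 2"
proof -
  have "(1::real) \<le> real b / p" using b(2) p by simp
  then have "2 powr - (real b / p) \<le> (2::real) powr - 1" by (intro powr_mono) auto
  then have "len k * 2 powr - (real b / p) \<le> len k * (1/2)"
    using len_pos[of k] by (intro mult_left_mono) (auto simp: powr_minus)
  then show ?thesis by (simp add: len_Suc)
qed

lemma len_antimono: "j \<le> k \<Longrightarrow> len k \<le> len j"
proof (induction rule: dec_induct)
  case (step n)
  then show ?case using len_Suc_le[of n] len_pos[of n] by linarith
qed simp

lemma len_le: "len k \<le> L" using len_antimono[of 0 k] by simp

lemma tau_Suc: "tau (Suc k) \<le> (\<alpha> - \<gamma>) / 8 * tau k"
proof -
  have "1 / 2 ^ b \<le> (\<alpha> - \<gamma>) / 8" using b(1) by (simp add: field_simps)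
  then have "tau k * (1 / 2 ^ b) \<le> tau k * ((\<alpha> - \<gamma>) / 8)"
    using tau_pos[of k] by (intro mult_left_mono) auto
  then show ?thesis by (simp add: tau_def power_add mult_ac)
qed

lemma tau_antimono: "j \<le> k \<Longrightarrow> tau k \<le> tau j"
  using len_antimono[of j k] len_pos[of k] p unfolding len_powr[symmetric]
  by (intro powr_mono2) auto

lemma len_depth: "L / 2 ^ depth k \<le> len k / 2" "len k / 4 \<le> L / 2 ^ depth k"
proof -
  let ?a = "real (b * k) / p"
  have a: "0 \<le> ?a" using p by simp
  have d: "L / 2 ^ depth k = L * 2 powr - real (depth k)"
    by (simp add: powr_minus powr_realpow divide_inverse)
  have 1: "?a + 1 \<le> real (depth k)" "real (depth k) \<le> ?a + 2"
    using a unfolding depth_def by linarith+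
  have "2 powr - real (depth k) \<le> (2::real) powr (- ?a - 1)" using 1 by (intro powr_mono) auto
  also have "\<dots> = 2 powr - ?a / 2" by (simp add: powr_diff)
  finally show "L / 2 ^ depth k \<le> len k / 2"
    unfolding d len_def using L by (simp add: mult_left_mono)
  have "2 powr - ?a / 4 = 2 powr (- ?a - 2)" by (simp add: powr_diff)
  also have "\<dots> \<le> 2 powr - real (depth k)" using 1 by (intro powr_mono) auto
  finally show "len k / 4 \<le> L / 2 ^ depth k"
    unfolding d len_def using L mult_left_mono[of "2 powr - ?a / 4" "2 powr - real (depth k)" L] by simp
qed

lemma depth_mono: "depth k \<le> depth (Suc k)"
proof -
  have "real (b * k) / p \<le> real (b * Suc k) / p" using p by (intro divide_right_mono) auto
  then show ?thesis unfolding depth_def by (intro add_right_mono nat_mono ceiling_mono)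
qed

lemma floor_refine:
  fixes w w' :: real
  assumes "m \<le> n" "\<lfloor>w * 2 ^ n\<rfloor> = \<lfloor>w' * 2 ^ n\<rfloor>"
  shows "\<lfloor>w * 2 ^ m\<rfloor> = \<lfloor>w' * 2 ^ m\<rfloor>"
proof -
  have "\<lfloor>y * 2 ^ m\<rfloor> = \<lfloor>y * 2 ^ n\<rfloor> div 2 ^ (n - m)" for y :: real
  proof -
    have "y * 2 ^ m = y * 2 ^ n / real_of_int (2 ^ (n - m))"
      using assms(1) power_diff[of "2::real" m n] by simp
    then show ?thesis by (simp only: floor_divide_real_eq_div zero_le_power zero_le_numeral)
  qed
  then show ?thesis using assms(2) by simp
qed

lemma idx_refine: assumes "idx (Suc k) z = idx (Suc k) z'" shows "idx k z = idx k z'"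
proof -
  have "b * k + e \<le> b * Suc k + e" by simp
  then show ?thesis
    using assms floor_refine[OF depth_mono] floor_refine[of "b * k + e" "b * Suc k + e"]
    unfolding idx_def prod.inject fun_eq_iff by blast
qed

lemma floor_eq_dist: "\<lfloor>w * 2 ^ n\<rfloor> = \<lfloor>w' * 2 ^ n\<rfloor> \<Longrightarrow> \<bar>w - w'\<bar> \<le> 1 / (2::real) ^ n"
proof -
  assume "\<lfloor>w * 2 ^ n\<rfloor> = \<lfloor>w' * 2 ^ n\<rfloor>"
  then have "\<bar>w * 2 ^ n - w' * 2 ^ n\<bar> \<le> 1" by linarith
  then have "\<bar>w - w'\<bar> * 2 ^ n \<le> 1" by (simp add: left_diff_distrib[symmetric] abs_mult)
  then show ?thesis by (simp add: field_simps)
qed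

lemma idx_dist:
  assumes "idx k z = idx k z'"
  shows "\<bar>fst z $ i - fst z' $ i\<bar> \<le> len k / 2" "\<bar>u z - u z'\<bar> \<le> slack k"
proof -
  have 1: "\<bar>(fst z $ i - x $ i) / L - (fst z' $ i - x $ i) / L\<bar> \<le> 1 / 2 ^ depth k"
    using assms by (intro floor_eq_dist) (auto simp: idx_def fun_eq_iff)
  have "(fst z $ i - x $ i) / L - (fst z' $ i - x $ i) / L = (fst z $ i - fst z' $ i) / L"
    by (simp add: diff_divide_distrib)
  then have "\<bar>fst z $ i - fst z' $ i\<bar> \<le> L / 2 ^ depth k"
    using 1 L by (simp add: abs_divide field_simps)
  then show "\<bar>fst z $ i - fst z' $ i\<bar> \<le> len k / 2" using len_depth(1)[of k] by linarith
  have Lp: "0 < L powr p" using L by simp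
  have "\<bar>u z / L powr p - u z' / L powr p\<bar> \<le> 1 / 2 ^ (b * k + e)"
    using assms by (intro floor_eq_dist) (auto simp: idx_def)
  then have "\<bar>u z - u z'\<bar> \<le> tau k * (1 / 2 ^ e)"
    using Lp by (simp add: diff_divide_distrib[symmetric] abs_divide tau_def power_add field_simps)
  also have "\<dots> \<le> tau k * ((1 - \<gamma>) / 8)"
    using e tau_pos[of k] by (intro mult_left_mono) (auto simp: field_simps)
  finally show "\<bar>u z - u z'\<bar> \<le> slack k" by (simp add: slack_def mult_ac)
qed

lemma rep: assumes "z \<in> X" shows "rep k (idx k z) \<in> X" "idx k (rep k (idx k z)) = idx k z"
  using someI[of "\<lambda>y. y \<in> X \<and> idx k y = idx k z" z] assms unfolding rep_def by auto

lemma in_signed_part: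
  "z \<in> signed_part p \<sigma> g y (t + \<sigma> * m) l \<longleftrightarrow>
    (\<forall>i. \<bar>fst z $ i - y $ i\<bar> \<le> l) \<and> g * l powr p < u z - m \<and> u z - m < l powr p"
  by (cases z) (auto simp: signed_part_def cube_def u_def right_diff_distrib \<sigma>2 distrib_left algebra_simps)

lemma in_prect: "z \<in> prect p y (t + \<sigma> * m) l \<longleftrightarrow>
    (\<forall>i. \<bar>fst z $ i - y $ i\<bar> \<le> l) \<and> \<bar>u z - m\<bar> < l powr p"
  unfolding prect_eq_signed_part[OF \<sigma>] in_signed_part by auto

lemma in_X: "z \<in> X \<longleftrightarrow> (\<forall>i. \<bar>fst z $ i - x $ i\<bar> \<le> L) \<and> \<alpha> * tau 0 < u z \<and> u z < tau 0"
  using in_signed_part[of z \<alpha> x 0 L] by (simp add: X_def tau_0)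

lemma in_Up: "z \<in> Up (k, i) \<longleftrightarrow> (\<forall>j. \<bar>fst z $ j - ctr k (rep k i) $ j\<bar> \<le> len k) \<and>
    \<gamma> * tau k < u z - mid k (rep k i) \<and> u z - mid k (rep k i) < tau k"
  by (simp add: Up_def box_of_def in_signed_part len_powr)

lemma in_P: "z \<in> P (k, i) \<longleftrightarrow> (\<forall>j. \<bar>fst z $ j - ctr k (rep k i) $ j\<bar> \<le> len k) \<and>
    \<bar>u z - mid k (rep k i)\<bar> < tau k"
  by (simp add: P_def box_of_def in_prect len_powr)

lemma ctr_near:
  assumes "z \<in> X" "idx k z = idx k y" "\<And>i. \<bar>fst y $ i - x $ i\<bar> \<le> L"
  shows "\<bar>fst y $ i - ctr k z $ i\<bar> \<le> len k"
proof -
  have "\<bar>fst z $ i - x $ i\<bar> \<le> L" using assms(1) in_X by auto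
  moreover have "fst z $ i - fst y $ i \<le> len k / 2" "fst y $ i - fst z $ i \<le> len k / 2"
    using idx_dist(1)[OF assms(2), of i] by linarith+
  ultimately show ?thesis
    using assms(3)[of i] len_pos[of k] len_le[of k] by (auto simp: ctr_def max_def min_def abs_le_iff)
qed

text \<open>The two points differ by at most \<open>len k / 2 \<le> len k - len (Suc k)\<close> in each coordinate. If \<open>z\<close> was not
moved, moving \<open>z'\<close> only brings it closer. If \<open>z\<close> was moved, its new position is at distance exactly \<open>len k\<close> from
a face of the ambient cube; the smaller cube does not cross that face, and \<open>z'\<close> is farther
inside by at most \<open>len k / 2\<close>.\<close>

lemma ctr_nested:
  assumes "z \<in> X" "z' \<in> X" "idx k z = idx k z'"
  shows "\<bar>ctr (Suc k) z' $ i - ctr k z $ i\<bar> \<le> len k - len (Suc k)"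
proof -
  have "\<bar>fst z $ i - x $ i\<bar> \<le> L" "\<bar>fst z' $ i - x $ i\<bar> \<le> L" using assms unfolding in_X by auto
  moreover have "fst z $ i - fst z' $ i \<le> len k / 2" "fst z' $ i - fst z $ i \<le> len k / 2"
    using idx_dist(1)[OF assms(3), of i] by linarith+
  ultimately show ?thesis
    using len_pos[of k] len_le[of k] len_pos[of "Suc k"] len_Suc_le[of k]
    by (auto simp: ctr_def max_def min_def abs_le_iff)
qed

lemma ctr_0: "ctr 0 z = x"
  by (simp add: ctr_def vec_eq_iff)

lemma gap: "0 < 1 - \<gamma>" "0 \<le> \<gamma> * tau k" "\<gamma> * tau k \<le> tau k"
  using \<gamma> \<alpha> tau_pos[of k] by (auto simp: mult_left_le_one_le)

lemma slack_pos: "0 < slack k"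
  using gap(1) tau_pos[of k] by (simp add: slack_def)

lemma tau_eq_slack: "tau k = \<gamma> * tau k + 8 * slack k"
proof -
  have "8 * slack k = (1 - \<gamma>) * tau k" by (simp add: slack_def)
  then show ?thesis by (simp add: left_diff_distrib)
qed

lemma tau_Suc_le: "tau (Suc k) \<le> slack k" "2 * tau (Suc k) \<le> \<alpha> * tau k - \<gamma> * tau k"
proof -
  have "(\<alpha> - \<gamma>) / 8 * tau k \<le> (1 - \<gamma>) / 8 * tau k"
    using \<alpha> tau_pos[of k] by (intro mult_right_mono) auto
  then show "tau (Suc k) \<le> slack k" using tau_Suc[of k] by (simp add: slack_def)
  have "(\<alpha> - \<gamma>) / 8 * tau k = (\<alpha> * tau k - \<gamma> * tau k) / 8" by (simp add: left_diff_distrib)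
  moreover have "\<gamma> * tau k \<le> \<alpha> * tau k" using \<alpha> tau_pos[of k] by (intro mult_right_mono) auto
  ultimately show "2 * tau (Suc k) \<le> \<alpha> * tau k - \<gamma> * tau k" using tau_Suc[of k] by simp
qed

lemma slack_le: "slack k \<le> tau k"
  using tau_eq_slack[of k] gap(2)[of k] slack_pos[of k] by linarith

lemma alpha_tau: "\<gamma> * tau k < \<alpha> * tau k" "\<alpha> * tau k < tau k"
  using \<gamma> \<alpha> tau_pos[of k] by auto

lemma mid_0: "mid 0 z = 0"
  by (simp add: mid_def)

lemma mid_upper:
  assumes "k \<noteq> 0" shows "mid k z \<le> u z - \<gamma> * tau k - 4 * slack k" "mid k z \<le> tau 0 - tau k"
  using assms by (simp_all add: mid_def)

lemma mid_cases:
  assumes "k \<noteq> 0"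
  obtains "mid k z = u z - \<gamma> * tau k - 4 * slack k" | "mid k z = tau 0 - tau k"
  using assms by (fastforce simp: mid_def min_def split: if_splits)

lemma mid_near:
  assumes "z \<in> X" "idx k z = idx k y" "y \<in> X"
  shows "\<gamma> * tau k < u y - mid k z" "u y - mid k z < tau k"
proof -
  have y: "\<alpha> * tau 0 < u y" "u y < tau 0" using assms(3) in_X by auto
  have d: "u z - u y \<le> slack k" "u y - u z \<le> slack k" using idx_dist(2)[OF assms(2)] by linarith+
  show "\<gamma> * tau k < u y - mid k z"
  proof (cases "k = 0")
    case True
    then show ?thesis using y alpha_tau(1)[of 0] by (simp add: mid_0)
  next
    case False
    then show ?thesis using mid_upper(1)[OF False, of z] d(1) slack_pos[of k] by linarith
  qed
  show "u y - mid k z < tau k"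
  proof (cases "k = 0")
    case True
    then show ?thesis using y by (simp add: mid_0)
  next
    case False
    then show ?thesis
    proof (cases rule: mid_cases[of k z])
      case 1
      then show ?thesis using d(2) slack_pos[of k] tau_eq_slack[of k] by linarith
    next
      case 2
      then show ?thesis using y by linarith
    qed
  qed
qed

text \<open>In generation \<open>0\<close> the bottom inequality uses that the points of \<open>X\<close> lie above the lag \<open>\<alpha>\<close>. Later
it uses that the representative of the parent lies at least \<open>4 * slack k\<close> above the lag \<open>\<gamma>\<close>. Of this, the
size of the cell takes up at most \<open>slack k\<close> and the whole child at most \<open>2 * slack k\<close>.\<close>

lemma mid_nested:
  assumes "z \<in> X" "z' \<in> X" "idx k z = idx k z'"
  shows "\<gamma> * tau k \<le> mid (Suc k) z' - tau (Suc k) - mid k z"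
    "mid (Suc k) z' + tau (Suc k) \<le> mid k z + tau k"
proof -
  have z': "\<alpha> * tau 0 < u z'" using assms in_X by auto
  have d: "u z - u z' \<le> slack k" "u z' - u z \<le> slack k" using idx_dist(2)[OF assms(3)] by linarith+
  have s: "0 < slack k" "0 < slack (Suc k)" by (rule slack_pos)+
  have G: "0 \<le> \<gamma> * tau (Suc k)" by (rule gap(2))
  show "\<gamma> * tau k \<le> mid (Suc k) z' - tau (Suc k) - mid k z"
  proof (rule mid_cases[of "Suc k" z'])
    assume m: "mid (Suc k) z' = u z' - \<gamma> * tau (Suc k) - 4 * slack (Suc k)"
    have m2: "u z' - 2 * tau (Suc k) \<le> mid (Suc k) z' - tau (Suc k)"
      using m s(2) tau_eq_slack[of "Suc k"] by linarith
    show ?thesis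
    proof (cases "k = 0")
      case True
      then show ?thesis using m2 z' tau_Suc_le(2)[of k] by (simp add: mid_0)
    next
      case False
      then show ?thesis using mid_upper(1)[OF False, of z] m2 d tau_Suc_le(1)[of k] s(1) by linarith
    qed
  next
    assume m: "mid (Suc k) z' = tau 0 - tau (Suc k)"
    show ?thesis
    proof (cases "k = 0")
      case True
      then show ?thesis using m alpha_tau(2)[of 0] tau_Suc_le(2)[of 0] by (simp add: mid_0)
    next
      case False
      then show ?thesis
        using mid_upper(2)[OF False, of z] m tau_eq_slack[of k] tau_Suc_le(1)[of k] s(1) by linarith
    qed
  qed simp
  show "mid (Suc k) z' + tau (Suc k) \<le> mid k z + tau k"
  proof (cases "k = 0")
    case True
    then show ?thesis using mid_upper(2)[of "Suc k" z'] by (simp add: mid_0)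
  next
    case False
    then show ?thesis
    proof (cases rule: mid_cases[of k z])
      case 1
      then show ?thesis
        using mid_upper(1)[of "Suc k" z'] G s d tau_eq_slack[of k] tau_Suc_le(1)[of k] by linarith
    next
      case 2
      then show ?thesis using mid_upper(2)[of "Suc k" z'] by linarith
    qed
  qed
qed

lemma X_in_Up:
  assumes "z \<in> X" "y \<in> X" "idx k y = idx k z" shows "y \<in> Up (k, idx k z)"
  using ctr_near[of "rep k (idx k z)" k y] mid_near[of "rep k (idx k z)" k y] rep[OF assms(1), of k] assms
  unfolding in_Up in_X by auto

lemma nested:
  assumes "z \<in> X" shows "P (Suc k, idx (Suc k) z) \<subseteq> Up (k, idx k z)"
proof
  fix y assume y: "y \<in> P (Suc k, idx (Suc k) z)"
  let ?w = "rep k (idx k z)" and ?w' = "rep (Suc k) (idx (Suc k) z)"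
  have w: "?w \<in> X" "?w' \<in> X" using rep[OF assms] by auto
  have i: "idx k ?w = idx k ?w'"
    using rep(2)[OF assms, of k] idx_refine[OF rep(2)[OF assms, of "Suc k"]] by simp
  have "\<bar>fst y $ j - ctr k ?w $ j\<bar> \<le> len k" for j
  proof -
    have "\<bar>fst y $ j - ctr (Suc k) ?w' $ j\<bar> \<le> len (Suc k)" using y unfolding in_P by blast
    then show ?thesis using ctr_nested[OF w i, of j] by linarith
  qed
  moreover have "\<bar>u y - mid (Suc k) ?w'\<bar> < tau (Suc k)" using y unfolding in_P by blast
  ultimately show "y \<in> Up (k, idx k z)" using mid_nested[OF w i] unfolding in_Up by auto
qed

lemma P_in: assumes "z \<in> X" shows "P (k, idx k z) \<subseteq> prect p x t L"
proof (cases k)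
  case 0
  then show ?thesis using in_prect[of _ x 0 L] by (auto simp: in_P ctr_0 mid_def tau_0)
next
  case (Suc j)
  have "Up (i, idx i z) \<subseteq> P (i, idx i z)" for i
    using gap(1) gap(2,3)[of i] by (auto simp: in_Up in_P)
  then have "P (Suc i, idx (Suc i) z) \<subseteq> P (i, idx i z)" for i using nested[OF assms] by blast
  then have "P (k, idx k z) \<subseteq> P (0, idx 0 z)" by (induction k) blast+
  also have "\<dots> \<subseteq> prect p x t L"
    using in_prect[of _ x 0 L] by (auto simp: in_P ctr_0 mid_def tau_0)
  finally show ?thesis .
qed

lemma cell_sets: "{z. idx k z = i} \<in> sets borel"
proof -
  have "{z. idx k z = i} = (\<Inter>j. {z. \<lfloor>(fst z $ j - x $ j) / L * 2 ^ depth k\<rfloor> = fst i j}) \<inter>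
      {z. \<lfloor>u z / L powr p * 2 ^ (b * k + e)\<rfloor> = snd i}"
    by (cases i) (auto simp: idx_def fun_eq_iff)
  also have "\<dots> \<in> sets borel"
  proof (intro sets.Int sets.finite_INT)
    have F: "{z. \<lfloor>g z\<rfloor> = m} \<in> sets borel" if "g \<in> borel_measurable borel" for g :: "(real^'n) \<times> real \<Rightarrow> real" and m
    proof -
      have "{z. \<lfloor>g z\<rfloor> = m} = g -` {real_of_int m ..< real_of_int m + 1}" by (auto simp: floor_eq_iff)
      then show ?thesis using measurable_sets_borel[OF that] by simp
    qed
    show "{z :: (real^'n) \<times> real. \<lfloor>(fst z $ j - x $ j) / L * 2 ^ depth k\<rfloor> = fst i j} \<in> sets borel" for j
      by (rule F) (intro borel_measurable_continuous_onI continuous_intros, use L in auto)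
    show "{z. \<lfloor>u z / L powr p * 2 ^ (b * k + e)\<rfloor> = snd i} \<in> sets borel"
      by (rule F) (unfold u_def, intro borel_measurable_continuous_onI continuous_intros, use L in auto)
  qed auto
  finally show ?thesis .
qed

text \<open>Both \<open>len k\<close> and \<open>tau k\<close> are at least halved from one generation to the next.\<close>

lemma cell_small:
  assumes "open T" "z \<in> T" shows "\<exists>k. {y. idx k y = idx k z} \<subseteq> T"
proof -
  obtain d where d: "0 < d" "\<And>y. dist y z < d \<Longrightarrow> y \<in> T"
    using assms unfolding open_dist by blast
  have l: "(\<lambda>k. real CARD('n) * (L * (1/2)^k) + L powr p * (1/2)^k) \<longlonglongrightarrow> real CARD('n) * (L * 0) + L powr p * 0"
    by (intro tendsto_intros) auto
  then have "eventually (\<lambda>k. real CARD('n) * (L * (1/2)^k) + L powr p * (1/2)^k < d) sequentially"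
    using d(1) by (intro order_tendstoD(2)[OF l]) auto
  then obtain k where k: "real CARD('n) * (L * (1/2)^k) + L powr p * (1/2)^k < d"
    by (auto simp: eventually_sequentially)
  have lk: "len k \<le> L * (1/2)^k"
  proof (induction k)
    case (Suc k) then show ?case using len_Suc_le[of k] by simp
  qed simp
  have tk: "tau k \<le> L powr p * (1/2)^k"
  proof (induction k)
    case (Suc k)
    have "(\<alpha> - \<gamma>) / 8 * tau k \<le> 1/2 * tau k"
      using \<gamma> \<alpha> tau_pos[of k] by (intro mult_right_mono) auto
    then show ?case using Suc tau_Suc[of k] by simp
  qed (simp add: tau_0)
  have "y \<in> T" if y: "idx k y = idx k z" for y
  proof (rule d(2))
    have "dist (fst y) (fst z) \<le> (\<Sum>i\<in>UNIV. \<bar>(fst y - fst z) $ i\<bar>)"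
      unfolding dist_norm by (rule norm_le_l1_cart)
    also have "\<dots> \<le> (\<Sum>i\<in>(UNIV::'n set). len k)"
    proof (rule sum_mono)
      fix i show "\<bar>(fst y - fst z) $ i\<bar> \<le> len k"
        using idx_dist(1)[OF y, of i] len_pos[of k] by simp
    qed
    also have "\<dots> \<le> real CARD('n) * (L * (1/2)^k)" using lk by simp
    finally have 1: "dist (fst y) (fst z) \<le> real CARD('n) * (L * (1/2)^k)" .
    have "dist (snd y) (snd z) = \<bar>u y - u z\<bar>"
      by (simp add: u_def dist_real_def right_diff_distrib[symmetric] abs_mult \<sigma>2)
    also have "\<dots> \<le> slack k" by (rule idx_dist(2)[OF y])
    also have "\<dots> \<le> tau k" by (rule slack_le)
    finally have 2: "dist (snd y) (snd z) \<le> L powr p * (1/2)^k" using tk by simp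
    have "dist y z \<le> dist (fst y) (fst z) + dist (snd y) (snd z)"
      unfolding dist_prod_def by (rule sqrt_sum_squares_le_sum) auto
    then show "dist y z < d" using 1 2 k by linarith
  qed
  then show ?thesis by blast
qed

abbreviation "\<kappa> \<equiv> cell_scale e"

lemma \<kappa>_pos: "0 < \<kappa>" and \<kappa>_le: "\<kappa> \<le> 1 / 16"
proof -
  have "\<kappa> = 1 / 2 ^ e * (1 / 16)" by (simp add: cell_scale_def power_add)
  moreover have "1 / 2 ^ e \<le> (1::real)" by (simp add: divide_le_eq_1)
  ultimately show "0 < \<kappa>" "\<kappa> \<le> 1 / 16" by simp_all
qed

lemma floor_from_middle:
  fixes s w :: real
  assumes s: "0 < s" and w: "\<bar>w - (real_of_int j + 1/2) * s\<bar> < s / 2"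
  shows "\<lfloor>w / s\<rfloor> = j"
proof (rule floor_unique)
  define y where "y = w / s - (real_of_int j + 1/2)"
  have "\<bar>w - (real_of_int j + 1/2) * s\<bar> = s * \<bar>w / s - (real_of_int j + 1/2)\<bar>"
    using s abs_mult[of s "w / s - (real_of_int j + 1/2)"] by (simp add: right_diff_distrib mult.commute)
  then have "s * \<bar>w / s - (real_of_int j + 1/2)\<bar> < s * (1/2)" using w by simp
  then have "\<bar>y\<bar> < 1/2" using s unfolding y_def by (simp only: mult_less_cancel_left_pos)
  then have "y < 1/2" "- (1/2) < y" by linarith+
  moreover have "w / s = y + real_of_int j + 1/2" by (simp add: y_def)
  ultimately show "real_of_int j \<le> w / s" "w / s < real_of_int j + 1" by simp_all
qed

text \<open>The rectangle around the midpoint of the cell. It is sought among parabolic rectangles, although any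
box would do, so that all volumes come from one formula and scale in the same way.\<close>

lemma cell_contains:
  "\<exists>y s. prect p y s (\<kappa> * len k) \<subseteq> {z'. idx k z' = idx k z}"
proof -
  \<comment> \<open>\<open>(y, t + \<sigma> * m)\<close> is the midpoint of the cell\<close>
  define y where "y = (\<chi> i. x $ i + (real_of_int (fst (idx k z) i) + 1/2) * (L / 2 ^ depth k))"
  define m where "m = (real_of_int (snd (idx k z)) + 1/2) * (tau k / 2 ^ e)"
  have \<kappa>: "0 < \<kappa>" "\<kappa> \<le> 1 / 16" "\<kappa> \<le> 1 / 2 / 2 ^ e" "\<kappa> \<le> 1"
    using \<kappa>_pos \<kappa>_le by (auto, simp add: cell_scale_def power_add frac_le)
  have c: "\<kappa> * len k < L / 2 ^ depth k / 2"
  proof -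
    have "\<kappa> * len k \<le> 1/16 * len k" using \<kappa> len_pos[of k] by (intro mult_right_mono) auto
    also have "\<dots> < len k / 4 / 2" using len_pos[of k] by simp
    also have "\<dots> \<le> L / 2 ^ depth k / 2" using len_depth(2)[of k] by (rule divide_right_mono) simp
    finally show ?thesis .
  qed
  have "(\<kappa> * len k) powr p = \<kappa> powr p * tau k" using \<kappa> len_pos[of k] by (simp add: powr_mult len_powr)
  also have "\<dots> \<le> \<kappa> powr 1 * tau k"
    using \<kappa> p tau_pos[of k] by (intro mult_right_mono powr_mono') auto
  also have "\<dots> \<le> 1 / 2 / 2 ^ e * tau k"
    using \<kappa> tau_pos[of k] by (intro mult_right_mono) auto
  finally have tt: "(\<kappa> * len k) powr p \<le> tau k / 2 ^ e / 2" by simp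
  have "idx k z' = idx k z" if z': "z' \<in> prect p y (t + \<sigma> * m) (\<kappa> * len k)" for z'
  proof -
    have "\<lfloor>(fst z' $ i - x $ i) / L * 2 ^ depth k\<rfloor> = fst (idx k z) i" for i
    proof -
      let ?s = "L / 2 ^ depth k" and ?j = "real_of_int (fst (idx k z) i)"
      have s: "0 < ?s" using L by simp
      have "\<bar>fst z' $ i - x $ i - (?j + 1/2) * ?s\<bar> \<le> \<kappa> * len k"
        using z' unfolding in_prect y_def by (auto simp: diff_diff_eq)
      then have "\<bar>(fst z' $ i - x $ i) - (?j + 1/2) * ?s\<bar> < ?s / 2" using c by linarith
      then have "\<lfloor>(fst z' $ i - x $ i) / ?s\<rfloor> = fst (idx k z) i" by (rule floor_from_middle[OF s])
      then show ?thesis by simp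
    qed
    moreover have "\<lfloor>u z' / L powr p * 2 ^ (b * k + e)\<rfloor> = snd (idx k z)"
    proof -
      let ?s = "tau k / 2 ^ e" and ?j = "real_of_int (snd (idx k z))"
      have s: "0 < ?s" using tau_pos[of k] by simp
      have "\<bar>u z' - (?j + 1/2) * ?s\<bar> < ?s / 2"
        using z' tt unfolding in_prect m_def by auto
      then have "\<lfloor>u z' / ?s\<rfloor> = snd (idx k z)" by (rule floor_from_middle[OF s])
      moreover have "u z' / ?s = u z' / L powr p * 2 ^ (b * k + e)" by (simp add: tau_def power_add)
      ultimately show ?thesis by simp
    qed
    ultimately show ?thesis by (auto simp: idx_def[of k z'] prod_eq_iff fun_eq_iff)
  qed
  then show ?thesis by blast
qed

lemma emeasure_Up: "emeasure lebesgue (Up v) = ennreal ((1 - \<gamma>) * rect_vol CARD('n) p (len (fst v)))"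
  using len_pos[of "fst v"] \<gamma> \<alpha> \<sigma> by (simp add: Up_def box_of_def emeasure_signed_part)

lemma emeasure_Lo: "emeasure lebesgue (Lo v) = ennreal ((1 - \<gamma>) * rect_vol CARD('n) p (len (fst v)))"
proof -
  have "- \<sigma> = 1 \<or> - \<sigma> = -1" using \<sigma> by auto
  then show ?thesis using len_pos[of "fst v"] \<gamma> \<alpha> by (simp add: Lo_def box_of_def emeasure_signed_part)
qed

lemma emeasure_prect:
  "0 \<le> l \<Longrightarrow> emeasure lebesgue (prect p (y :: real^'n) s l) = ennreal (2 * rect_vol CARD('n) p l)"
  by (subst prect_eq_signed_part[of 1]) (auto simp: emeasure_signed_part)

lemma Dil_le: "emeasure lebesgue (Dil v) \<le> ennreal (dilation_ratio CARD('n) p \<gamma>) * emeasure lebesgue (Up v)"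
proof -
  have "emeasure lebesgue (Dil v) = ennreal (2 * rect_vol CARD('n) p (5 * len (fst v)))"
    using len_pos[of "fst v"] by (simp add: Dil_def box_of_def emeasure_prect)
  also have "2 * rect_vol CARD('n) p (5 * len (fst v)) = dilation_ratio CARD('n) p \<gamma> * ((1 - \<gamma>) * rect_vol CARD('n) p (len (fst v)))"
    using len_pos[of "fst v"] \<gamma> \<alpha> by (subst rect_vol_scale) (auto simp: dilation_ratio_def)
  also have "ennreal \<dots> = ennreal (dilation_ratio CARD('n) p \<gamma>) * emeasure lebesgue (Up v)"
    unfolding emeasure_Up using \<gamma> \<alpha> len_pos[of "fst v"] rect_vol_pos[of "len (fst v)" "CARD('n)" p]
    by (intro ennreal_mult) (auto simp: dilation_ratio_def)
  finally show ?thesis by simp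
qed

lemma scaled_cell_bounds: "0 < \<kappa> * 2 powr - (real b / p)" "\<kappa> * 2 powr - (real b / p) \<le> 1"
proof -
  have "2 powr - (real b / p) \<le> (2::real) powr 0" using p by (intro powr_mono) auto
  then have "\<kappa> * 2 powr - (real b / p) \<le> 1 * 1" using \<kappa>_le by (intro mult_mono) auto
  then show "\<kappa> * 2 powr - (real b / p) \<le> 1" by simp
qed (use \<kappa>_pos in simp)

lemma cell_ratio_ge_1: "1 \<le> cell_ratio CARD('n) p b e"
proof -
  have "(\<kappa> * 2 powr - (real b / p)) ^ CARD('n) * (\<kappa> * 2 powr - (real b / p)) powr p \<le> 1 * 1"
    using scaled_cell_bounds p by (intro mult_mono power_le_one powr_le1) auto
  moreover have "0 < (\<kappa> * 2 powr - (real b / p)) ^ CARD('n) * (\<kappa> * 2 powr - (real b / p)) powr p"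
    using \<kappa>_pos by (intro mult_pos_pos zero_less_power) auto
  ultimately show ?thesis by (simp only: cell_ratio_def pos_le_divide_eq mult_1)
qed

lemma dilation_ratio_ge_1: "1 \<le> dilation_ratio CARD('n) p \<gamma>"
proof -
  have "1 * 1 \<le> (5::real) ^ CARD('n) * 5 powr p"
    using p by (intro mult_mono ge_one_powr_ge_zero one_le_power) auto
  then show ?thesis using \<gamma> \<alpha> unfolding dilation_ratio_def by (simp add: field_simps)
qed

lemma Up_le_cell: "emeasure lebesgue (Up (k, i)) \<le> ennreal (cell_ratio CARD('n) p b e) * emeasure lebesgue {z'. idx (Suc k) z' = idx (Suc k) z}"
proof -
  obtain y s where ys: "prect p y s (\<kappa> * len (Suc k)) \<subseteq> {z'. idx (Suc k) z' = idx (Suc k) z}"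
    using cell_contains by blast
  let ?a = "\<kappa> * 2 powr - (real b / p)"
  have V: "0 < rect_vol CARD('n) p (len k)" using len_pos by (rule rect_vol_pos)
  have "emeasure lebesgue (Up (k, i)) \<le> ennreal (2 * rect_vol CARD('n) p (len k))"
    unfolding emeasure_Up using V \<gamma> by (intro ennreal_leI mult_right_mono) auto
  also have "2 * rect_vol CARD('n) p (len k) = cell_ratio CARD('n) p b e * (2 * rect_vol CARD('n) p (\<kappa> * len (Suc k)))"
  proof -
    have "\<kappa> * len (Suc k) = ?a * len k" by (simp add: len_Suc)
    moreover have "?a ^ CARD('n) * ?a powr p \<noteq> 0" using \<kappa>_pos by simp
    ultimately show ?thesis using scaled_cell_bounds(1) len_pos[of k] by (simp only: rect_vol_scale[OF less_imp_le less_imp_le] cell_ratio_def) simp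
  qed
  also have "ennreal \<dots> = ennreal (cell_ratio CARD('n) p b e) * emeasure lebesgue (prect p y s (\<kappa> * len (Suc k)))"
    using cell_ratio_ge_1 rect_vol_pos[of "\<kappa> * len (Suc k)" "CARD('n)" p] len_pos[of "Suc k"]
    by (subst emeasure_prect) (auto simp: cell_scale_def intro!: ennreal_mult)
  also have "\<dots> \<le> ennreal (cell_ratio CARD('n) p b e) * emeasure lebesgue {z'. idx (Suc k) z' = idx (Suc k) z}"
    using ys cell_sets[of "Suc k" "idx (Suc k) z"] by (intro mult_left_mono emeasure_mono) auto
  finally show ?thesis .
qed

text \<open>Every point of the cell is close to the representative, which lies in the rectangle of the cell, and this
rectangle is no larger than the one it meets. In time the factor \<open>5\<close> of the dilation suffices as \<open>5 \<le> 5 powr p\<close>.\<close>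

lemma cell_in_Dil:
  assumes z: "z \<in> X" and z': "z' \<in> X" and jk: "j \<le> k"
    and meet: "(k, idx k z) = (j, idx j z') \<or> P (k, idx k z) \<inter> P (j, idx j z') \<noteq> {}"
  shows "{y. idx k y = idx k z} \<subseteq> Dil (j, idx j z')"
proof
  fix y assume "y \<in> {y. idx k y = idx k z}"
  then have y: "idx k y = idx k z" by simp
  let ?w = "rep k (idx k z)" and ?w' = "rep j (idx j z')"
  have w: "?w \<in> X" "idx k ?w = idx k y" using rep[OF z, of k] y by auto
  have "?w \<in> Up (k, idx k z)" using X_in_Up[OF z w(1)] w(2) y by simp
  then have wP: "\<And>i. \<bar>fst ?w $ i - ctr k ?w $ i\<bar> \<le> len k" "\<bar>u ?w - mid k ?w\<bar> < tau k"
    using gap(1) gap(2,3)[of k] unfolding in_Up by auto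
  have "?w \<in> P (k, idx k z)" using wP by (simp add: in_P)
  then obtain q where q: "q \<in> P (k, idx k z)" "q \<in> P (j, idx j z')" using meet by (cases "(k, idx k z) = (j, idx j z')") (simp_all, blast+)
  have "\<bar>fst y $ i - ctr j ?w' $ i\<bar> \<le> 5 * len j" for i
  proof -
    have "\<bar>fst q $ i - ctr k ?w $ i\<bar> \<le> len k" "\<bar>fst q $ i - ctr j ?w' $ i\<bar> \<le> len j"
      using q unfolding in_P by auto
    moreover have "\<bar>fst y $ i - fst q $ i\<bar> \<le> 3 * len k"
      using wP(1)[of i] idx_dist(1)[OF w(2), of i] calculation(1) len_pos[of k] by linarith
    ultimately show ?thesis using len_antimono[OF jk] len_pos[of k] by linarith
  qed
  moreover have "\<bar>u y - mid j ?w'\<bar> < (5 * len j) powr p"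
  proof -
    have "\<bar>u q - mid k ?w\<bar> < tau k" "\<bar>u q - mid j ?w'\<bar> < tau j" using q unfolding in_P by auto
    then have "\<bar>u y - mid j ?w'\<bar> < 5 * tau j"
      using slack_le[of k] wP(2) idx_dist(2)[OF w(2)] tau_antimono[OF jk] tau_pos[of k] by linarith
    also have "5 * tau j \<le> 5 powr p * tau j"
      using p powr_mono[of 1 p 5] tau_pos[of j] by (intro mult_right_mono) auto
    also have "\<dots> = (5 * len j) powr p" using len_pos[of j] by (simp add: powr_mult len_powr)
    finally show ?thesis .
  qed
  ultimately show "y \<in> Dil (j, idx j z')" by (simp add: Dil_def box_of_def in_prect)
qed

end

section \<open>The weak type estimate\<close>

lemma signed_part_antimono: "g \<le> h \<Longrightarrow> signed_part p \<sigma> h y s l \<subseteq> signed_part p \<sigma> g y s l"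
  using mult_right_mono[of g h "l powr p"] by (auto simp: signed_part_def)

lemma ennpowr_mono: "0 \<le> a \<Longrightarrow> x \<le> y \<Longrightarrow> ennpowr x a \<le> ennpowr y a"
  by (auto simp: ennpowr_def top_unique less_top intro!: ennreal_leI powr_mono2 enn2real_mono)

lemma PJN_term_eq_minimum:
  assumes "\<forall>d. lag_osc r (prect_upper p \<gamma> y s l) (prect_lower p \<gamma> y s l) f c
      \<le> lag_osc r (prect_upper p \<gamma> y s l) (prect_lower p \<gamma> y s l) f d" "0 < q" "0 < r"
  shows "PJN_term p q \<gamma> r f y s l = emeasure lebesgue (prect_upper p \<gamma> y s l) *
    ennpowr (lag_osc r (prect_upper p \<gamma> y s l) (prect_lower p \<gamma> y s l) f c) (q / r)"
proof -
  have "(INF c. ennpowr (lag_osc r (prect_upper p \<gamma> y s l) (prect_lower p \<gamma> y s l) f c) (q / r))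
      = ennpowr (lag_osc r (prect_upper p \<gamma> y s l) (prect_lower p \<gamma> y s l) f c) (q / r)"
    using assms by (intro antisym INF_greatest INF_lower ennpowr_mono) auto
  then show ?thesis by (simp add: PJN_term_def lag_osc_def)
qed

lemma finite_PJN_sum_le:
  assumes "finite S" "S \<in> PJN_families p R"
  shows "(\<Sum>(y, s, l)\<in>S. PJN_term p q \<gamma> r f y s l) \<le> PJN_sup p q \<gamma> r R f"
  unfolding PJN_sup_def using assms by (intro SUP_upper2[of S]) auto

text \<open>Finiteness of the seminorm, applied to a family with one member, makes the minimum finite, so that the
oscillation \<open>a = enn2real (F c) powr (1 / r)\<close> is a genuine real number with \<open>a\<^sup>r\<close> equal to the minimum.\<close>

lemma PJN_minimum:
  fixes y :: "real^'n"
  assumes f: "f \<in> PJN p q \<gamma> r R" and R: "R \<in> sets lebesgue" "prect p y s l \<subseteq> R" and l: "0 < l"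
    and \<gamma>: "0 \<le> \<gamma>" "\<gamma> < 1" and q: "0 < q" and r: "0 < r"
  defines "F \<equiv> lag_osc r (prect_upper p \<gamma> y s l) (prect_lower p \<gamma> y s l) f"
  shows "\<exists>c. \<forall>d. F c \<le> F d"
    and "\<forall>d. F c \<le> F d \<Longrightarrow> F c = ennreal ((enn2real (F c) powr (1 / r)) powr r)"
    and "\<forall>d. F c \<le> F d \<Longrightarrow> PJN_term p q \<gamma> r f y s l
      = emeasure lebesgue (prect_upper p \<gamma> y s l) * ennreal ((enn2real (F c) powr (1 / r)) powr q)"
proof -
  let ?A = "prect_upper p \<gamma> y s l" and ?B = "prect_lower p \<gamma> y s l"
  have AB: "?A \<in> sets lebesgue" "?B \<in> sets lebesgue"
    unfolding prect_upper_eq_signed_part prect_lower_eq_signed_part by (rule signed_part_sets)+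
  have "0 \<le> \<gamma> * l powr p" using \<gamma> by simp
  then have sub: "?A \<subseteq> R" "?B \<subseteq> R"
    using R(2) by (auto simp: prect_def prect_upper_def prect_lower_def dest!: subsetD)
  have m: "emeasure lebesgue ?A = ennreal ((1 - \<gamma>) * rect_vol CARD('n) p l)"
    "emeasure lebesgue ?B = ennreal ((1 - \<gamma>) * rect_vol CARD('n) p l)"
    using l \<gamma> unfolding prect_upper_eq_signed_part prect_lower_eq_signed_part by (auto intro!: emeasure_signed_part)
  have pos: "0 < (1 - \<gamma>) * rect_vol CARD('n) p l" using rect_vol_pos[OF l] \<gamma> by simp
  have fm: "f \<in> borel_measurable (lebesgue_on R)" using f by (simp add: PJN_def L_loc_def)
  show "\<exists>c. \<forall>d. F c \<le> F d"
    unfolding F_def by (rule exists_minimizer[OF AB sub R(1) m(1) pos m(2) pos fm r])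
  assume c: "\<forall>d. F c \<le> F d"
  have term_eq: "PJN_term p q \<gamma> r f y s l = emeasure lebesgue ?A * ennpowr (F c) (q / r)"
    using PJN_term_eq_minimum[OF c[unfolded F_def] q r] by (simp add: F_def)
  have "{(y, s, l)} \<in> PJN_families p R"
    using R l by (auto simp: PJN_families_def disjoint_family_on_def)
  from finite_PJN_sum_le[OF _ this, of q \<gamma> r f]
  have "PJN_term p q \<gamma> r f y s l \<le> PJN_sup p q \<gamma> r R f" by simp
  also have "\<dots> < \<infinity>" using f by (simp add: PJN_def)
  finally have "ennpowr (F c) (q / r) \<noteq> \<infinity>"
    using pos unfolding term_eq m by (auto simp: ennreal_mult_top split: if_splits)
  then have fin: "F c \<noteq> \<infinity>" by (auto simp: ennpowr_def)
  have F0: "F c = ennreal (enn2real (F c))" using fin by (simp add: less_top)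
  then show "F c = ennreal ((enn2real (F c) powr (1 / r)) powr r)"
    using r by (simp add: powr_powr)
  have "ennpowr (F c) (q / r) = ennreal ((enn2real (F c) powr (1 / r)) powr q)"
    using fin by (simp add: ennpowr_def powr_powr)
  then show "PJN_term p q \<gamma> r f y s l
      = emeasure lebesgue ?A * ennreal ((enn2real (F c) powr (1 / r)) powr q)"
    using term_eq by simp
qed

text \<open>The oscillation is invariant under reversing time together with \<open>f \<mapsto> -f\<close>, \<open>c \<mapsto> -c\<close>; for this reason one
minimiser serves both estimates.\<close>

lemma lag_osc_signed:
  assumes "\<sigma> = 1 \<or> \<sigma> = -1"
  shows "lag_osc r (prect_upper p \<gamma> y s l) (prect_lower p \<gamma> y s l) f c =
    nn_average (signed_part p \<sigma> \<gamma> y s l) (\<lambda>z. max (\<sigma> * (f z - c)) 0 powr r) +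
    nn_average (signed_part p (- \<sigma>) \<gamma> y s l) (\<lambda>z. max (- \<sigma> * (f z - c)) 0 powr r)"
proof -
  have n: "neg_part w = max (- w) 0" "pos_part w = max w 0" for w
    by (auto simp: neg_part_def pos_part_def)
  show ?thesis
    using assms by (auto simp: lag_osc_def prect_upper_eq_signed_part prect_lower_eq_signed_part n add.commute)
qed

context parabolic_grid
begin

text \<open>The grid instantiates the abstract tree with the function \<open>\<sigma> f\<close> and with minimising constants, where the
given \<open>c0\<close> is used for the ambient rectangle. The packing hypothesis of the tree is the definition of the
seminorm for the finite family of the selected rectangles.\<close>

theorem weak_type_signed:
  assumes f: "f \<in> PJN p q \<gamma> r (prect p x t L)" and q: "0 < q" and r: "0 < r"
    and c0: "\<forall>d. lag_osc r (prect_upper p \<gamma> x t L) (prect_lower p \<gamma> x t L) f c0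
      \<le> lag_osc r (prect_upper p \<gamma> x t L) (prect_lower p \<gamma> x t L) f d"
    and \<mu>: "0 < \<mu>"
  shows "emeasure lebesgue {z \<in> signed_part p \<sigma> \<alpha> x t L. \<sigma> * (f z - c0) > \<mu>}
    \<le> ennreal (weak_const (cell_ratio CARD('n) p b e) (dilation_ratio CARD('n) p \<gamma>) q r * enn2real (PJN_sup p q \<gamma> r (prect p x t L) f) / \<mu> powr q)"
proof -
  let ?R = "prect p x t L"
  define F where "F B = (case B of (y, s, l) \<Rightarrow>
    lag_osc r (prect_upper p \<gamma> y s l) (prect_lower p \<gamma> y s l) f)" for B
  define cc where "cc B = (if B = (x, t, L) then c0 else (SOME c. \<forall>d. F B c \<le> F B d))" for B
  define aa where "aa B = enn2real (F B (cc B)) powr (1 / r)" for B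
  have \<gamma>1: "\<gamma> < 1" using \<alpha> by simp
  have Rs: "?R \<in> sets lebesgue" unfolding prect_eq_signed_part[OF \<sigma>] by (rule signed_part_sets)
  have fm: "f \<in> borel_measurable (lebesgue_on ?R)" using f by (simp add: PJN_def L_loc_def)
  have supfin: "PJN_sup p q \<gamma> r ?R f < \<infinity>" using f by (simp add: PJN_def)
  have good: "\<exists>y s l. box_of (k, idx k z) = (y, s, l) \<and> 0 < l \<and> prect p y s l \<subseteq> ?R" if "z \<in> X" for k z
    using P_in[OF that, of k] len_pos by (auto simp: box_of_def P_def)
  have minimal: "\<forall>d. F (y, s, l) (cc (y, s, l)) \<le> F (y, s, l) d" if "0 < l" "prect p y s l \<subseteq> ?R" for y s l
  proof (cases "(y, s, l) = (x, t, L)")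
    case True
    then show ?thesis using c0 by (simp add: F_def cc_def)
  next
    case False
    have "\<exists>c. \<forall>d. F (y, s, l) c \<le> F (y, s, l) d"
      using PJN_minimum(1)[OF f Rs that(2,1) \<gamma> \<gamma>1 q r] by (simp add: F_def)
    then have "\<forall>d. F (y, s, l) (SOME c. \<forall>d. F (y, s, l) c \<le> F (y, s, l) d) \<le> F (y, s, l) d"
      by (rule someI_ex)
    moreover have "cc (y, s, l) = (SOME c. \<forall>d. F (y, s, l) c \<le> F (y, s, l) d)"
      unfolding cc_def by (rule if_not_P[OF False])
    ultimately show ?thesis by simp
  qed
  have osc: "emeasure lebesgue {z \<in> signed_part p \<tau> \<gamma> y s l. \<tau> * (f z - cc (y, s, l)) > h}
      \<le> ennreal ((aa (y, s, l) / h) powr r) * emeasure lebesgue (signed_part p \<tau> \<gamma> y s l)"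
    if l: "0 < l" "prect p y s l \<subseteq> ?R" and h: "0 < h" and \<tau>: "\<tau> = 1 \<or> \<tau> = -1" for \<tau> y s l h
  proof (rule weak_type_average[OF signed_part_sets _ Rs _ _ fm r _ _ h])
    have "signed_part p \<tau> \<gamma> y s l \<subseteq> signed_part p \<tau> (-1) y s l" using \<gamma> by (intro signed_part_antimono) auto
    then show "signed_part p \<tau> \<gamma> y s l \<subseteq> ?R" using l(2) prect_eq_signed_part[OF \<tau>, of p y s l] by simp
    show "emeasure lebesgue (signed_part p \<tau> \<gamma> y s l) = ennreal ((1 - \<gamma>) * rect_vol CARD('n) p l)"
      using l \<gamma>1 \<tau> by (intro emeasure_signed_part) auto
    show "0 < (1 - \<gamma>) * rect_vol CARD('n) p l" using rect_vol_pos[OF l(1)] \<gamma>1 by simp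
    have "nn_average (signed_part p \<tau> \<gamma> y s l) (\<lambda>z. max (\<tau> * (f z - cc (y, s, l))) 0 powr r)
        \<le> F (y, s, l) (cc (y, s, l))"
      unfolding F_def prod.case lag_osc_signed[OF \<tau>] by simp
    also have "\<dots> = ennreal (aa (y, s, l) powr r)"
      using PJN_minimum(2)[OF f Rs l(2,1) \<gamma> \<gamma>1 q r] minimal[OF l] by (simp add: F_def aa_def)
    finally show "nn_average (signed_part p \<tau> \<gamma> y s l) (\<lambda>z. max (\<tau> * (f z - cc (y, s, l))) 0 powr r)
        \<le> ennreal (aa (y, s, l) powr r)" .
  qed (simp add: aa_def)
  have \<sigma>': "- \<sigma> = 1 \<or> - \<sigma> = -1" using \<sigma> by auto
  have tree: "cell_tree X idx P Up Lo Dil ?R (\<lambda>z. \<sigma> * f z) (\<lambda>v. \<sigma> * cc (box_of v)) (\<lambda>v. aa (box_of v))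
    (\<sigma> * c0) (enn2real (PJN_sup p q \<gamma> r ?R f))
    (cell_ratio CARD('n) p b e) (dilation_ratio CARD('n) p \<gamma>) q r"
  proof (unfold_locales)
    fix k z z' assume "idx (Suc k) z = idx (Suc k) z'" then show "idx k z = idx k z'" by (rule idx_refine)
  next
    fix v show "{z. idx (fst v) z = snd v} \<in> sets lebesgue" using cell_sets by (intro sets_completionI_sets) simp
  next
    fix T :: "((real^'n) \<times> real) set" and z assume "open T" "z \<in> T"
    then show "\<exists>k. {za. idx (fst (k, idx k z)) za = snd (k, idx k z)} \<subseteq> T"
      using cell_small[of T z] by simp
  next
    show "X \<in> sets lebesgue" unfolding X_def by (rule signed_part_sets)
  next
    have "signed_part p \<sigma> \<alpha> x t L \<subseteq> signed_part p \<sigma> (-1) x t L" using \<gamma> \<alpha> by (intro signed_part_antimono) auto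
    then show "X \<subseteq> ?R" unfolding X_def prect_eq_signed_part[OF \<sigma>] .
  next
    show "?R \<in> sets lebesgue" by (rule Rs)
  next
    show "emeasure lebesgue ?R < \<infinity>" using L by (simp add: emeasure_prect)
  next
    fix v show "Up v \<in> sets lebesgue" "Lo v \<in> sets lebesgue"
      by (auto simp: Up_def Lo_def signed_part_sets split: prod.split)
  next
    fix v show "Dil v \<in> sets lebesgue"
      by (auto simp: Dil_def signed_part_sets prect_eq_signed_part[OF \<sigma>] split: prod.split)
  next
    fix v show "Up v \<subseteq> P v"
      unfolding Up_def P_def prect_eq_signed_part[OF \<sigma>] using \<gamma> by (cases "box_of v") (simp add: signed_part_antimono)
  next
    fix v show "Lo v \<subseteq> P v"
      unfolding Lo_def P_def prect_eq_signed_part[OF \<sigma>'] using \<gamma> by (cases "box_of v") (simp add: signed_part_antimono)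
  next
    fix v assume "v \<in> {(k, idx k z) |k z. z \<in> X}"
    then show "P v \<subseteq> ?R" using P_in by auto
  next
    fix v assume "v \<in> {(k, idx k z) |k z. z \<in> X}"
    then show "X \<inter> {z. idx (fst v) z = snd v} \<subseteq> Up v" using X_in_Up by auto
  next
    fix z k assume "z \<in> X"
    then show "P (Suc k, idx (Suc k) z) \<subseteq> Up (k, idx k z)" by (rule nested)
  next
    fix v show "emeasure lebesgue (Lo v) = emeasure lebesgue (Up v)" by (simp add: emeasure_Up emeasure_Lo)
  next
    fix z k assume "z \<in> X"
    show "emeasure lebesgue (Up (k, idx k z)) \<le> ennreal (cell_ratio CARD('n) p b e) *
        emeasure lebesgue {za. idx (fst (Suc k, idx (Suc k) z)) za = snd (Suc k, idx (Suc k) z)}"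
      using Up_le_cell by simp
  next
    fix v show "emeasure lebesgue (Dil v) \<le> ennreal (dilation_ratio CARD('n) p \<gamma>) * emeasure lebesgue (Up v)" by (rule Dil_le)
  next
    fix v w assume "v \<in> {(k, idx k z) |k z. z \<in> X}" "w \<in> {(k, idx k z) |k z. z \<in> X}"
      "fst w \<le> fst v" "v = w \<or> P v \<inter> P w \<noteq> {}"
    moreover then obtain k z j z' where "v = (k, idx k z)" "z \<in> X" "w = (j, idx j z')" "z' \<in> X" by blast
    ultimately show "{z. idx (fst v) z = snd v} \<subseteq> Dil w" using cell_in_Dil[of z z' j k] by simp
  next
    fix h
    have "(\<lambda>z. \<sigma> * f z) \<in> borel_measurable (lebesgue_on ?R)" using fm by measurable
    then have "{z \<in> space (lebesgue_on ?R). h < \<sigma> * f z} \<in> sets (lebesgue_on ?R)" by measurable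
    then show "{z \<in> ?R. h < \<sigma> * f z} \<in> sets lebesgue"
      using Rs by (auto simp: sets_restrict_space_iff space_restrict_space)
  next
    fix v h assume v: "v \<in> {(k, idx k z) |k z. z \<in> X}" and h: "0 < (h::real)"
    obtain y s l where B: "box_of v = (y, s, l)" "0 < l" "prect p y s l \<subseteq> ?R" using good v by blast
    show "emeasure lebesgue {z \<in> Up v. h < \<sigma> * f z - \<sigma> * cc (box_of v)}
        \<le> ennreal ((aa (box_of v) / h) powr r) * emeasure lebesgue (Up v)"
      using osc[OF B(2,3) h \<sigma>] by (simp only: Up_def B prod.case right_diff_distrib)
    show "emeasure lebesgue {z \<in> Lo v. h < \<sigma> * cc (box_of v) - \<sigma> * f z}
        \<le> ennreal ((aa (box_of v) / h) powr r) * emeasure lebesgue (Lo v)"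
      using osc[OF B(2,3) h \<sigma>']
      by (simp only: Lo_def B prod.case right_diff_distrib mult_minus_left minus_diff_minus minus_diff_eq)
  next
    fix v show "0 \<le> aa (box_of v)" by (simp add: aa_def)
  next
    fix V assume V: "finite V" "V \<subseteq> {(k, idx k z) |k z. z \<in> X}" "disjoint_family_on P V"
    have Bv: "\<exists>y s l. box_of v = (y, s, l) \<and> 0 < l \<and> prect p y s l \<subseteq> ?R" if "v \<in> V" for v
      using good that V(2) by blast
    \<comment> \<open>equal boxes would give equal nonempty rectangles, against disjointness\<close>
    have inj: "inj_on box_of V"
    proof (rule inj_onI, rule ccontr)
      fix v w assume vw: "v \<in> V" "w \<in> V" "box_of v = box_of w" "v \<noteq> w"
      then have "P v = P w" by (simp add: P_def)
      moreover have "P v \<noteq> {}"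
      proof -
        obtain y s l where B: "box_of v = (y, s, l)" "0 < l" using Bv[OF vw(1)] by blast
        then have "(y, s) \<in> P v" by (simp add: P_def prect_def cube_def)
        then show ?thesis by blast
      qed
      ultimately show False using V(3) vw unfolding disjoint_family_on_def by blast
    qed
    have fam: "box_of ` V \<in> PJN_families p ?R"
      unfolding PJN_families_def
    proof (intro CollectI conjI)
      show "countable (box_of ` V)" using V(1) by (simp add: countable_finite)
      show "\<forall>(y, s, l)\<in>box_of ` V. 0 < l \<and> prect p y s l \<subseteq> ?R" using Bv by fastforce
      show "disjoint_family_on (\<lambda>(y, s, l). prect p y s l) (box_of ` V)"
        unfolding disjoint_family_on_def
      proof (intro ballI impI)
        fix B B' assume B: "B \<in> box_of ` V" "B' \<in> box_of ` V" "B \<noteq> B'"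
        then obtain v w where vw: "v \<in> V" "w \<in> V" "B = box_of v" "B' = box_of w" by blast
        have "v \<noteq> w" using B(3) vw(3,4) by auto
        then have "P v \<inter> P w = {}" by (rule disjoint_family_onD[OF V(3) vw(1,2)])
        then show "(\<lambda>(y, s, l). prect p y s l) B \<inter> (\<lambda>(y, s, l). prect p y s l) B' = {}"
          by (simp add: P_def vw)
      qed
    qed
    have "(\<Sum>v\<in>V. emeasure lebesgue (Up v) * ennreal (aa (box_of v) powr q))
        = (\<Sum>v\<in>V. (\<lambda>(y, s, l). PJN_term p q \<gamma> r f y s l) (box_of v))"
    proof (rule sum.cong)
      fix v assume "v \<in> V"
      then obtain y s l where B: "box_of v = (y, s, l)" "0 < l" "prect p y s l \<subseteq> ?R" using Bv by blast
      have "emeasure lebesgue (prect_upper p \<gamma> y s l) = emeasure lebesgue (Up v)"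
        using B(2) \<gamma>1 unfolding emeasure_Up prect_upper_eq_signed_part
        by (subst emeasure_signed_part) (use B(1) in \<open>auto simp: box_of_def\<close>)
      then show "emeasure lebesgue (Up v) * ennreal (aa (box_of v) powr q)
          = (\<lambda>(y, s, l). PJN_term p q \<gamma> r f y s l) (box_of v)"
        using PJN_minimum(3)[OF f Rs B(3,2) \<gamma> \<gamma>1 q r] minimal[OF B(2,3)] by (simp add: B F_def aa_def)
    qed simp
    also have "\<dots> = (\<Sum>(y, s, l)\<in>box_of ` V. PJN_term p q \<gamma> r f y s l)"
      by (simp add: sum.reindex[OF inj])
    also have "\<dots> \<le> PJN_sup p q \<gamma> r ?R f" using V(1) fam by (intro finite_PJN_sum_le) auto
    finally show "(\<Sum>v\<in>V. emeasure lebesgue (Up v) * ennreal (aa (box_of v) powr q))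
        \<le> ennreal (enn2real (PJN_sup p q \<gamma> r ?R f))" using supfin by simp
  next
    fix z assume "z \<in> X"
    have "box_of (0, idx 0 z) = (x, t, L)" by (simp add: box_of_def ctr_0 mid_def)
    then show "\<sigma> * cc (box_of (0, idx 0 z)) = \<sigma> * c0" by (simp add: cc_def)
  qed (simp_all add: cell_ratio_ge_1 dilation_ratio_ge_1 q r)
  show ?thesis using cell_tree.weak_type[OF tree \<mu>] by (simp only: X_def right_diff_distrib)
qed

end

theorem theorem3p1:
  fixes p q r \<gamma> \<alpha> :: real
  assumes "1 < p" and "0 \<le> \<gamma>" and "\<gamma> < \<alpha>" and "\<alpha> < 1" and "1 < q" and "0 < r" and "r \<le> 1"
  shows "\<exists>C>0. \<forall>(x :: real^'n) t L f.
    L > 0 \<and> f \<in> PJN p q \<gamma> r (prect p x t L) \<longrightarrow>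
    (\<exists>c::real. \<forall>\<mu>>0.
      emeasure lebesgue {z \<in> prect_upper p \<alpha> x t L. pos_part (f z - c) > \<mu>}
        \<le> ennreal (C * (PJN_norm p q \<gamma> r (prect p x t L) f) powr q / \<mu> powr q) \<and>
      emeasure lebesgue {z \<in> prect_lower p \<alpha> x t L. neg_part (f z - c) > \<mu>}
        \<le> ennreal (C * (PJN_norm p q \<gamma> r (prect p x t L) f) powr q / \<mu> powr q))"
proof -
  obtain b0 :: nat where b0: "8 / (\<alpha> - \<gamma>) < 2 ^ b0" using real_arch_pow[of 2] by auto
  obtain b1 :: nat where b1: "p \<le> real b1" using real_arch_simple by blast
  obtain e :: nat where e0: "8 / (1 - \<gamma>) < 2 ^ e" using real_arch_pow[of 2] by auto
  define b where "b = max b0 b1"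
  have "(2::real) ^ b0 \<le> 2 ^ b" by (rule power_increasing) (auto simp: b_def)
  then have "8 / (\<alpha> - \<gamma>) \<le> 2 ^ b" using b0 by linarith
  then have b: "8 \<le> (\<alpha> - \<gamma>) * 2 ^ b" using assms by (simp add: field_simps)
  have bp: "p \<le> real b" using b1 by (simp add: b_def)
  have e: "8 \<le> (1 - \<gamma>) * 2 ^ e" using e0 assms by (simp add: field_simps)
  have grid: "parabolic_grid p \<gamma> \<alpha> \<sigma> L b e" if "\<sigma> = 1 \<or> \<sigma> = -1" "0 < L" for \<sigma> L
    using assms b bp e that by unfold_locales auto
  define C where "C = weak_const (cell_ratio CARD('n) p b e) (dilation_ratio CARD('n) p \<gamma>) q r"
  have C: "0 < C"
    using assms by (simp add: C_def weak_const_def tolerance_def cell_ratio_def dilation_ratio_def cell_scale_def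
        add_pos_pos)
  show ?thesis
  proof (rule exI[of _ C], intro conjI C allI impI, elim conjE)
    fix x :: "real^'n" and t L :: real and f
    assume L: "0 < L" and f: "f \<in> PJN p q \<gamma> r (prect p x t L)"
    let ?N = "PJN_norm p q \<gamma> r (prect p x t L) f"
    have N: "?N powr q = enn2real (PJN_sup p q \<gamma> r (prect p x t L) f)"
      using assms by (simp add: PJN_norm_def powr_powr)
    have R: "prect p x t L \<in> sets lebesgue"
      unfolding prect_eq_signed_part[of 1, simplified] by (rule signed_part_sets)
    obtain c where c: "\<forall>d. lag_osc r (prect_upper p \<gamma> x t L) (prect_lower p \<gamma> x t L) f c
        \<le> lag_osc r (prect_upper p \<gamma> x t L) (prect_lower p \<gamma> x t L) f d"
      using PJN_minimum(1)[OF f R order.refl L] assms by auto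
    have w: "emeasure lebesgue {z \<in> signed_part p \<sigma> \<alpha> x t L. \<sigma> * (f z - c) > \<mu>}
        \<le> ennreal (C * ?N powr q / \<mu> powr q)" if "\<sigma> = 1 \<or> \<sigma> = -1" "0 < \<mu>" for \<sigma> \<mu>
      unfolding C_def N
      by (rule parabolic_grid.weak_type_signed[OF grid[OF that(1) L] f _ _ c that(2)]) (use assms in auto)
    show "\<exists>c. \<forall>\<mu>>0.
      emeasure lebesgue {z \<in> prect_upper p \<alpha> x t L. pos_part (f z - c) > \<mu>}
        \<le> ennreal (C * ?N powr q / \<mu> powr q) \<and>
      emeasure lebesgue {z \<in> prect_lower p \<alpha> x t L. neg_part (f z - c) > \<mu>}
        \<le> ennreal (C * ?N powr q / \<mu> powr q)"
    proof (intro exI[of _ c] allI impI conjI)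
      fix \<mu> :: real assume \<mu>: "0 < \<mu>"
      have "pos_part y > \<mu> \<longleftrightarrow> 1 * y > \<mu>" for y
        using \<mu> by (auto simp: pos_part_def)
      then have "{z \<in> prect_upper p \<alpha> x t L. pos_part (f z - c) > \<mu>} = {z \<in> signed_part p 1 \<alpha> x t L. 1 * (f z - c) > \<mu>}"
        by (simp only: prect_upper_eq_signed_part)
      then show "emeasure lebesgue {z \<in> prect_upper p \<alpha> x t L. pos_part (f z - c) > \<mu>}
          \<le> ennreal (C * ?N powr q / \<mu> powr q)" using w[of 1, OF _ \<mu>] by simp
      have "neg_part y > \<mu> \<longleftrightarrow> -1 * y > \<mu>" for y
        using \<mu> by (auto simp: neg_part_def)
      then have "{z \<in> prect_lower p \<alpha> x t L. neg_part (f z - c) > \<mu>} = {z \<in> signed_part p (-1) \<alpha> x t L. -1 * (f z - c) > \<mu>}"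
        by (simp only: prect_lower_eq_signed_part)
      then show "emeasure lebesgue {z \<in> prect_lower p \<alpha> x t L. neg_part (f z - c) > \<mu>}
          \<le> ennreal (C * ?N powr q / \<mu> powr q)" using w[of "-1", OF _ \<mu>] by simp
    qed
  qed
qed

end
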